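(* Let $R(z,q)$ and $C(z,q)$ be the rank and crank generating functions, $R^{*}(z,q)=R(z,q)/(1-z)$, $C^{*}(z,q)=C(z,q)/(1-z)$, $\delta_z=z\frac{\partial}{\partial z}$, $\delta_q=q\frac{\partial}{\partial q}$, and $(q)_\infty=\prod_{n\ge1}(1-q^n)$. Then $$z\,(q)_\infty^2\,\left[C^{*}(z,q)\right]^3=\left(3\delta_q+\tfrac12\delta_z+\tfrac12\delta_z^2\right)R^{*}(z,q),$$ and $$z\,(q)_\infty^2\,\left[C(z,q)\right]^3=\left(3(1-z)^2\delta_q+\tfrac12(1-z)^2\delta_z^2-\tfrac12(z^2-1)\delta_z+z\right)R(z,q).$$
   Context: The rank of a partition is its largest part minus its number of parts. $N(m,n)$ is the number of partitions of $n$ with rank $m$; $N(0,0)=1$ and $N(m,0)=0$ for $m\ne0$. The crank of a partition is its largest part if the partition contains no ones; otherwise it is (the number of parts larger than the number of ones) minus (the number of ones). For $n\ge2$, $M(m,n)$ is the number of partitions of $n$ with crank $m$. By convention $M(0,0)=1$ and $M(m,0)=0$ for $m\neq0$; and $M(0,1)=-1$, $M(-1,1)=M(1,1)=1$, $M(m,1)=0$ otherwise. The generating functions are $$R(z,q)=\sum_{n\ge0}\sum_m N(m,n)z^mq^n=1+\sum_{n\ge1}\frac{q^{n^2}}{(zq)_n(z^{-1}q)_n},\qquad C(z,q)=\sum_{n\ge0}\sum_m M(m,n)z^mq^n=\prod_{n\ge1}\frac{1-q^n}{(1-zq^n)(1-z^{-1}q^n)},$$ where $(a)_n=(1-a)(1-aq)\cdots(1-aq^{n-1})$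 (these second equalities are known). Here $|q|<1$; the identities may be read as identities of formal power series in $q$ whose coefficients are rational functions of $z$. *)

theory Defs
  imports
    "HOL-Library.Multiset"
    "HOL-Computational_Algebra.Computational_Algebra"
    "HOL-Computational_Algebra.Field_as_Ring"
    "HOL-Analysis.Infinite_Products"
begin

text \<open>
  A partition of \<open>n\<close> is the multiset of its parts.
\<close>

definition partitions_of :: "nat \<Rightarrow> nat multiset set" where
  "partitions_of n = {p. 0 \<notin># p \<and> sum_mset p = n}"

text \<open>
  \<open>partition_rank\<close> and \<open>partition_crank\<close> are only meaningful for nonempty partitions; \<open>Max\<close> is never
  used on the empty multiset, since \<open>N_rank\<close> and \<open>M_crank\<close> treat \<open>n = 0\<close> separately.
\<close>

definition partition_rank :: "nat multiset \<Rightarrow> int" where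
  "partition_rank p = int (Max (set_mset p)) - int (size p)"

definition partition_crank :: "nat multiset \<Rightarrow> int" where
  "partition_crank p =
     (if 1 \<notin># p then int (Max (set_mset p))
      else int (size {#k \<in># p. k > count p 1#}) - int (count p 1))"

definition N_rank :: "int \<Rightarrow> nat \<Rightarrow> nat" where
  "N_rank m n =
     (if n = 0 then (if m = 0 then 1 else 0)
      else card {p \<in> partitions_of n. partition_rank p = m})"

definition M_crank :: "int \<Rightarrow> nat \<Rightarrow> int" where
  "M_crank m n =
     (if n = 0 then (if m = 0 then 1 else 0)
      else if n = 1 then (if m = 0 then -1 else if m = 1 \<or> m = -1 then 1 else 0)
      else int (card {p \<in> partitions_of n. partition_crank p = m}))"

lemma finite_partitions_of: "finite (partitions_of n)"
proof -
  have "partitions_of n \<subseteq> mset ` {xs. set xs \<subseteq> {0..n} \<and> length xs \<le> n}"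
  proof
    fix p assume p: "p \<in> partitions_of n"
    obtain xs where xs: "p = mset xs" by (metis ex_mset)
    have s: "sum_list xs = n" and z: "0 \<notin> set xs"
      using p xs by (auto simp: partitions_of_def sum_mset_sum_list)
    have "length xs \<le> sum_list xs" using z
      by (induction xs) (auto simp: Suc_le_eq)
    moreover have "\<forall>x\<in>set xs. x \<le> sum_list xs"
      by (simp add: member_le_sum_list)
    ultimately show "p \<in> mset ` {xs. set xs \<subseteq> {0..n} \<and> length xs \<le> n}"
      using xs s by auto
  qed
  moreover have "finite {xs. set xs \<subseteq> {0..n} \<and> length xs \<le> n}"
    by (rule finite_lists_length_le) simp
  ultimately show ?thesis by (meson finite_imageI finite_subset)
qed

lemma partitions_of_bounds:
  assumes "p \<in> partitions_of n"
  shows "size p \<le> n" and "k \<in># p \<Longrightarrow> k \<le> n"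
proof -
  obtain xs where xs: "p = mset xs" by (metis ex_mset)
  have s: "sum_list xs = n" and z: "0 \<notin> set xs"
    using assms xs by (auto simp: partitions_of_def sum_mset_sum_list)
  have "length xs \<le> sum_list xs" using z
    by (induction xs) (auto simp: Suc_le_eq)
  then show "size p \<le> n" using xs s by simp
  show "k \<le> n" if "k \<in># p"
    using that xs s member_le_sum_list[of k xs] by simp
qed

lemma partitions_of_nonempty:
  assumes "p \<in> partitions_of n" "n > 0"
  shows "p \<noteq> {#}"
  using assms by (auto simp: partitions_of_def)

lemma Max_partitions_of_le:
  assumes "p \<in> partitions_of n" "n > 0"
  shows "Max (set_mset p) \<le> n"
  using partitions_of_bounds(2)[OF assms(1)] partitions_of_nonempty[OF assms] by simp

lemma N_rank_eq_0:
  assumes "m \<notin> {- int n..int n}"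
  shows "N_rank m n = 0"
proof (cases "n = 0")
  case False
  have "partition_rank p \<in> {- int n..int n}" if "p \<in> partitions_of n" for p
    using partitions_of_bounds(1)[OF that] Max_partitions_of_le[OF that] False
    by (auto simp: partition_rank_def)
  then have "{p \<in> partitions_of n. partition_rank p = m} = {}" using assms by auto
  then show ?thesis using False unfolding N_rank_def by (simp only: card.empty if_False)
qed (use assms in \<open>auto simp: N_rank_def\<close>)

lemma M_crank_eq_0:
  assumes "m \<notin> {- int n..int n}"
  shows "M_crank m n = 0"
proof (cases "n \<le> 1")
  case False
  have "partition_crank p \<in> {- int n..int n}" if "p \<in> partitions_of n" for p
  proof -
    have "size {#k \<in># p. k > count p 1#} \<le> n"
      using size_mset_mono[OF multiset_filter_subset] partitions_of_bounds(1)[OF that]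
      by (rule order_trans)
    moreover have "count p 1 \<le> size p" by (rule count_le_size)
    ultimately show ?thesis
      using partitions_of_bounds(1)[OF that] Max_partitions_of_le[OF that] False
      by (auto simp: partition_crank_def simp del: One_nat_def)
  qed
  then have "{p \<in> partitions_of n. partition_crank p = m} = {}" using assms by auto
  then show ?thesis using False unfolding M_crank_def by (simp only:) simp
qed (use assms in \<open>auto simp: M_crank_def le_Suc_eq\<close>)

type_synonym ratfun = "complex poly fract"

text \<open>
  \<open>ratfun\<close> is the field of rational functions in the indeterminate \<open>z\<close>, and
  \<open>ratfun_deriv\<close> is \<open>d/dz\<close> on it, given by the quotient rule in lowest terms;
  by \<open>ratfun_deriv_Fract\<close> any representation may be used.
\<close>

definition ratfun_deriv :: "ratfun \<Rightarrow> ratfun" where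
  "ratfun_deriv r =
     (case quot_of_fract r of (a, b) \<Rightarrow> Fract (pderiv a * b - a * pderiv b) (b ^ 2))"

lemma ratfun_deriv_Fract:
  assumes "b \<noteq> 0"
  shows "ratfun_deriv (Fract a b) = Fract (pderiv a * b - a * pderiv b) (b ^ 2)"
proof -
  obtain c d where cd: "quot_of_fract (Fract a b) = (c, d)" by (cases "quot_of_fract (Fract a b)")
  have d: "d \<noteq> 0" using snd_quot_of_fract_nonzero[of "Fract a b"] cd by simp
  have "Fract c d = Fract a b"
    using Fract_quot_of_fract[of "Fract a b"] cd by simp
  then have eq: "a * d = c * b" using assms d by (simp add: eq_fract)
  then have "pderiv (a * d) = pderiv (c * b)" by simp
  then have eq': "a * pderiv d + d * pderiv a = c * pderiv b + b * pderiv c"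
    by (simp add: pderiv_mult)
  have "(pderiv c * d - c * pderiv d) * b\<^sup>2 = (pderiv a * b - a * pderiv b) * d\<^sup>2"
    using eq eq' by algebra
  then show ?thesis using assms d cd by (simp add: ratfun_deriv_def eq_fract)
qed

definition zvar :: ratfun where
  "zvar = Fract [:0, 1:] 1"

text \<open>
  Formal power series in \<open>q\<close> (which is \<open>fps_X\<close>) over the rational functions in \<open>z\<close>.
  By \<open>N_rank_eq_0\<close> and \<open>M_crank_eq_0\<close>, the sums below range over all \<open>m\<close>
  with a nonzero coefficient.
\<close>

definition R_gf :: "ratfun fps" where
  "R_gf = Abs_fps (\<lambda>n. \<Sum>m = - int n..int n. of_nat (N_rank m n) * zvar powi m)"

definition C_gf :: "ratfun fps" where
  "C_gf = Abs_fps (\<lambda>n. \<Sum>m = - int n..int n. of_int (M_crank m n) * zvar powi m)"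

definition R_star :: "ratfun fps" where
  "R_star = R_gf / fps_const (1 - zvar)"

definition C_star :: "ratfun fps" where
  "C_star = C_gf / fps_const (1 - zvar)"

definition delta_z :: "ratfun fps \<Rightarrow> ratfun fps" where
  "delta_z F = Abs_fps (\<lambda>n. zvar * ratfun_deriv (fps_nth F n))"

definition delta_q :: "ratfun fps \<Rightarrow> ratfun fps" where
  "delta_q F = fps_X * fps_deriv F"

text \<open>
  This infinite product is taken in the \<open>q\<close>-adic topology of formal power series.
\<close>

definition q_infty :: "ratfun fps" where
  "q_infty = (\<Prod>n. 1 - fps_X ^ Suc n)"

lemma convergent_prod_q_infty: "convergent_prod (\<lambda>n. 1 - fps_X ^ Suc n :: ratfun fps)"
proof -
  define P :: "nat \<Rightarrow> ratfun fps" where "P = (\<lambda>n. \<Prod>i\<le>n. 1 - fps_X ^ Suc i)"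
  define L where "L = Abs_fps (\<lambda>k. fps_nth (P k) k)"
  have step: "fps_nth (P (Suc n)) k = fps_nth (P n) k" if "k \<le> n" for n k
  proof -
    have "P (Suc n) = P n - P n * fps_X ^ Suc (Suc n)"
      by (simp add: P_def algebra_simps)
    then show ?thesis using that
      by (simp add: fps_X_power_mult_right_nth del: power_Suc)
  qed
  have stable: "fps_nth (P n) k = fps_nth (P k) k" if "k \<le> n" for n k
    using that by (induction rule: dec_induct) (simp_all add: step)
  have "P \<longlonglongrightarrow> L"
  proof (rule tendsto_fpsI)
    fix k
    show "eventually (\<lambda>n. fps_nth (P n) k = fps_nth L k) sequentially"
      using eventually_ge_at_top[of k] unfolding L_def fps_nth_Abs_fps by (rule eventually_mono) (rule stable)
  qed
  moreover have "fps_nth L 0 = 1"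
    by (simp add: L_def P_def)
  then have "L \<noteq> 0" by auto
  ultimately show ?thesis
    unfolding convergent_prod_def raw_has_prod_def P_def by (intro exI[of _ 0] exI[of _ L]) simp
qed

end

theory Submission
  imports Defs
begin

text \<open>
  Write \<open>S = R / (1 - z)\<close> and \<open>D = 6 \<delta>\<^sub>q + \<delta>\<^sub>z + \<delta>\<^sub>z\<^sup>2\<close>. Dyson's bijection (remove the first
  column of length \<open>l\<close> of a Young diagram and add a row of length \<open>l + r\<close>) says that \<open>S\<close> satisfies
  \<open>S(zq) + q z\<^sup>3 S(z) = 1 - q z\<^sup>2\<close>. The operator \<open>D\<close> turns this into the homogeneous equation
  \<open>(D S)(zq) = - q z\<^sup>3 (D S)(z)\<close>. If \<open>\<theta>(z) = \<Prod> (1 - z q\<^sup>k) (1 - q\<^sup>k / z)\<close>, then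
  \<open>V = ((1 - z) \<theta>)\<^sup>3 D S\<close> satisfies \<open>V(zq) = q V(z)\<close>, so that only the coefficient of \<open>z\<^sup>1\<close> in \<open>V\<close>
  survives, and \<open>V\<close> is found by setting \<open>z = 1\<close>. Finally \<open>C = (q)\<^sub>\<infinity> / \<theta>\<close> by the q-binomial theorem,
  after sorting partitions by their number of ones.
\<close>

subsection \<open>The derivation on rational functions\<close>

text \<open>The obstacle is the pole of S at z = 1. The functional equation lives on an annulus 1 <
  |z| < 1/|q|, where S(zq) has to be expanded in ascending powers of z but S(z) in descending ones.
  At a fixed order of q neither is a Laurent polynomial in z, so S is kept as two coefficient
  arrays, counting the ranks at most m and, with a minus sign, the ranks above m. The pole of D S
  has order three, and multiplication by \<open>(1 - z)^3\<close> sends both images under D to the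
  same Laurent array; from there on V is one object.

  D is made for the equation: its eigenvalue \<open>6 n + m^2 + m\<close> on \<open>z^m q^n\<close>
  agrees at the two places that the equation links and vanishes at the two inhomogeneous terms.
  Since (1 - z) \<theta> picks up -1/z under z -> zq, the multiplier \<open>- q z^3\<close> asks for
  its cube, and this is where the cube of C comes from.

  No infinite product in two variables is formed: \<theta> is cut off at N, which costs end factors
  that do not affect the orders up to N.\<close>

lemma two_ratfun_neq_0: "(2 :: ratfun) \<noteq> 0"
proof -
  have "(2 :: ratfun) = Fract 2 1"
    by (metis Fract_of_nat_eq of_nat_numeral)
  then show ?thesis unfolding Zero_fract_def by (metis eq_fract(1) mult.right_neutral zero_neq_numeral zero_neq_one)
qed

lemma zvar_neq_0: "zvar \<noteq> 0"
  by (simp add: zvar_def eq_fract Zero_fract_def)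

lemma zvar_neq_1: "zvar \<noteq> 1"
  by (simp add: zvar_def eq_fract One_fract_def one_pCons)

lemma ratfun_deriv_add: "ratfun_deriv (r + s) = ratfun_deriv r + ratfun_deriv s"
proof (cases r, cases s)
  fix a b c d assume "r = Fract a b" "b \<noteq> 0" "s = Fract c d" "d \<noteq> 0"
  then show ?thesis
    by (simp add: ratfun_deriv_Fract eq_fract pderiv_add pderiv_mult)
       (simp add: algebra_simps power2_eq_square power4_eq_xxxx)
qed

lemma ratfun_deriv_mult: "ratfun_deriv (r * s) = ratfun_deriv r * s + r * ratfun_deriv s"
proof (cases r, cases s)
  fix a b c d assume "r = Fract a b" "b \<noteq> 0" "s = Fract c d" "d \<noteq> 0"
  then show ?thesis
    by (simp add: ratfun_deriv_Fract eq_fract pderiv_mult)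
       (simp add: algebra_simps power2_eq_square power4_eq_xxxx)
qed

lemma ratfun_deriv_zvar: "ratfun_deriv zvar = 1"
  by (simp add: zvar_def ratfun_deriv_Fract pderiv_pCons One_fract_def flip: one_pCons)

lemma ratfun_deriv_1: "ratfun_deriv 1 = 0"
  using ratfun_deriv_mult[of 1 1] by (metis add_cancel_right_right mult_1 mult.right_neutral)

lemma ratfun_deriv_0: "ratfun_deriv 0 = 0"
  using ratfun_deriv_add[of 0 0] by (metis add_cancel_right_right)

lemma ratfun_deriv_uminus: "ratfun_deriv (- r) = - ratfun_deriv r"
  using ratfun_deriv_add[of r "- r"] by (simp add: ratfun_deriv_0 minus_unique)

lemma ratfun_deriv_diff: "ratfun_deriv (r - s) = ratfun_deriv r - ratfun_deriv s"
  using ratfun_deriv_add[of r "- s"] by (simp add: ratfun_deriv_uminus)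

lemma ratfun_deriv_of_nat: "ratfun_deriv (of_nat k) = 0"
  by (induction k) (simp_all add: ratfun_deriv_0 ratfun_deriv_1 ratfun_deriv_add)

lemma ratfun_deriv_of_int: "ratfun_deriv (of_int k) = 0"
  by (cases k) (simp_all add: ratfun_deriv_of_nat ratfun_deriv_uminus ratfun_deriv_diff ratfun_deriv_1)

lemma ratfun_deriv_sum: "ratfun_deriv (\<Sum>x\<in>A. f x) = (\<Sum>x\<in>A. ratfun_deriv (f x))"
  by (induction A rule: infinite_finite_induct) (simp_all add: ratfun_deriv_0 ratfun_deriv_add)

text \<open>Makes \<open>delta_z\<close> diagonal on coefficient arrays. The downward step cancels
  the invertible \<open>zvar\<close> from the product rule.\<close>

lemma zvar_times_deriv_powi: "zvar * ratfun_deriv (zvar powi m) = of_int m * zvar powi m"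
proof -
  have *: "zvar * ratfun_deriv (zvar powi (k + 1)) =
      zvar powi (k + 1) + zvar * (zvar * ratfun_deriv (zvar powi k))" for k
    using zvar_neq_0 by (simp add: power_int_add_1 ratfun_deriv_mult ratfun_deriv_zvar distrib_left mult.left_commute)
  show ?thesis
  proof (induction m rule: int_induct[where k = 0])
    case base
    show ?case by (simp add: ratfun_deriv_1)
  next
    case (step1 i)
    show ?case unfolding * step1 using zvar_neq_0
      by (simp add: power_int_add_1 distrib_left distrib_right mult.commute mult.left_commute)
  next
    case (step2 i)
    have "zvar * (zvar * ratfun_deriv (zvar powi (i - 1))) = zvar * (of_int (i - 1) * zvar powi (i - 1))"
      using *[of "i - 1"] step2 power_int_add_1[of zvar "i - 1"]
      by (simp add: zvar_neq_0 algebra_simps)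
    then show ?case using zvar_neq_0 by simp
  qed
qed

subsection \<open>Partitions weighted by their parts, and the q-binomial theorem\<close>

text \<open>This is the product of \<open>1 / (1 - w k * q^k)\<close> over k \<ge> 1, kept as a sum
  over partitions so that combinatorial and algebraic arguments act on the same object. A weight 0
  deletes a factor.\<close>

definition weighted_gf :: "(nat \<Rightarrow> 'a::comm_ring_1) \<Rightarrow> 'a fps" where
  "weighted_gf w = Abs_fps (\<lambda>n. \<Sum>p\<in>partitions_of n. \<Prod>k\<in>#p. w k)"

lemma weighted_gf_nth: "weighted_gf w $ n = (\<Sum>p\<in>partitions_of n. \<Prod>k\<in>#p. w k)"
  by (simp add: weighted_gf_def)

lemma partitions_of_0: "partitions_of 0 = {{#}}"
proof -
  have "p = {#}" if "p \<in> partitions_of 0" for p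
    using that by (cases p) (auto simp: partitions_of_def)
  then show ?thesis by (auto simp: partitions_of_def)
qed

lemma partitions_of_containing:
  assumes "k \<ge> 1"
  shows "{p \<in> partitions_of n. k \<in># p} = (if n < k then {} else add_mset k ` partitions_of (n - k))"
proof -
  have "p \<in> add_mset k ` partitions_of (n - k) \<and> \<not> n < k" if p: "p \<in> partitions_of n" "k \<in># p" for p
  proof -
    obtain q where "p = add_mset k q" using p(2) by (metis mset_add)
    then show ?thesis using p by (auto simp: partitions_of_def)
  qed
  then show ?thesis using assms by (auto simp: partitions_of_def)
qed

lemma prod_mset_eq_0_if:
  "k \<in># p \<Longrightarrow> w k = (0::'a::comm_ring_1) \<Longrightarrow> (\<Prod>i\<in>#p. w i) = 0"
  by (metis mset_add image_mset_add_mset prod_mset.add_mset mult_zero_left)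

lemma prod_mset_fun_cong:
  "(\<And>i. i \<in># p \<Longrightarrow> w i = w' i) \<Longrightarrow> (\<Prod>i\<in>#p. w i) = (\<Prod>i\<in>#p. w' i)"
  by (metis image_mset_cong)

lemma weighted_gf_cong:
  assumes "\<And>k. 1 \<le> k \<Longrightarrow> k \<le> n \<Longrightarrow> w k = w' k"
  shows "weighted_gf w $ n = weighted_gf w' $ n"
  unfolding weighted_gf_nth
proof (intro sum.cong refl prod_mset_fun_cong assms)
  fix p k assume p: "p \<in> partitions_of n" "k \<in># p"
  then show "1 \<le> k" by (metis (mono_tags, lifting) partitions_of_def mem_Collect_eq not_less_eq_eq le_0_eq One_nat_def)
  show "k \<le> n" using p by (rule partitions_of_bounds)
qed

lemma weighted_gf_eqI:
  assumes "\<And>k. 1 \<le> k \<Longrightarrow> w k = w' k"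
  shows "weighted_gf w = weighted_gf w'"
  using assms by (intro fps_ext weighted_gf_cong)

lemma weighted_gf_0: "weighted_gf (\<lambda>_. 0) = 1"
proof (rule fps_ext)
  fix n
  have "(\<Prod>k\<in>#p. 0 :: 'a) = 0" if p: "p \<in> partitions_of n" "n > 0" for p
  proof -
    obtain k where "k \<in># p" using partitions_of_nonempty[OF p] by auto
    then show ?thesis by (rule prod_mset_eq_0_if) simp
  qed
  then show "weighted_gf (\<lambda>_. 0 :: 'a) $ n = 1 $ n"
    by (cases "n = 0") (simp_all add: weighted_gf_nth partitions_of_0)
qed

text \<open>Removing one copy of k from the partitions that contain it gives all partitions of n -
  k, hence \<open>w k * q^k\<close> times the whole series; what the subtraction leaves avoids
  k.\<close>

lemma weighted_gf_factor:
  assumes "k \<ge> 1"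
  shows "(1 - fps_const (w k) * fps_X ^ k) * weighted_gf w = weighted_gf (w(k := 0))"
proof (rule fps_ext)
  fix n
  let ?A = "{p \<in> partitions_of n. k \<in># p}" and ?B = "{p \<in> partitions_of n. k \<notin># p}"
  have split: "(\<Sum>p\<in>partitions_of n. g p) = (\<Sum>p\<in>?A. g p) + (\<Sum>p\<in>?B. g p)" for g :: "_ \<Rightarrow> 'a"
    by (subst sum.union_disjoint[symmetric]) (auto simp: finite_partitions_of intro: sum.cong)
  have "(\<Sum>p\<in>?A. \<Prod>i\<in>#p. w i) = (fps_const (w k) * (fps_X ^ k * weighted_gf w)) $ n"
  proof (cases "n < k")
    case True
    then have A: "?A = {}" using partitions_of_containing[OF assms, of n] by simp
    show ?thesis unfolding A using True by (simp add: fps_X_power_mult_nth)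
  next
    case False
    then have A: "?A = add_mset k ` partitions_of (n - k)"
      using partitions_of_containing[OF assms, of n] by simp
    show ?thesis unfolding A using False
      by (subst sum.reindex) (auto simp: fps_X_power_mult_nth weighted_gf_nth sum_distrib_left inj_on_def)
  qed
  moreover have "(\<Sum>p\<in>?A. \<Prod>i\<in>#p. (w(k := 0)) i) = 0"
    by (intro sum.neutral ballI prod_mset_eq_0_if[of k]) auto
  moreover have "(\<Sum>p\<in>?B. \<Prod>i\<in>#p. (w(k := 0)) i) = (\<Sum>p\<in>?B. \<Prod>i\<in>#p. w i)"
    by (intro sum.cong refl prod_mset_fun_cong) auto
  ultimately have "weighted_gf w $ n - (fps_const (w k) * (fps_X ^ k * weighted_gf w)) $ n = weighted_gf (w(k := 0)) $ n"
    unfolding weighted_gf_nth split[of "\<lambda>p. \<Prod>i\<in>#p. w i"] split[of "\<lambda>p. \<Prod>i\<in>#p. (w(k := 0)) i"]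
    by (simp only: add_0 add_diff_cancel_left')
  then show "((1 - fps_const (w k) * fps_X ^ k) * weighted_gf w) $ n = weighted_gf (w(k := 0)) $ n"
    by (simp only: left_diff_distrib mult_1 fps_sub_nth mult.assoc)
qed

lemma weighted_gf_prod_factor:
  "(\<Prod>k=1..N. 1 - fps_const (w k) * fps_X ^ k) * weighted_gf w = weighted_gf (\<lambda>k. if k \<le> N then 0 else w k)"
proof (induction N)
  case 0
  show ?case by (simp, intro weighted_gf_eqI) simp
next
  case (Suc N)
  let ?w = "\<lambda>k. if k \<le> N then 0 else w k"
  have "(\<Prod>k=1..Suc N. 1 - fps_const (w k) * fps_X ^ k) * weighted_gf w =
        (1 - fps_const (?w (Suc N)) * fps_X ^ Suc N) * weighted_gf ?w"
    unfolding Suc[symmetric] by (simp add: ac_simps)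
  also have "\<dots> = weighted_gf (?w(Suc N := 0))" by (rule weighted_gf_factor) simp
  also have "\<dots> = weighted_gf (\<lambda>k. if k \<le> Suc N then 0 else w k)" by (intro weighted_gf_eqI) auto
  finally show ?case .
qed

section \<open>Equality of power series up to order N\<close>

definition eq_upto :: "nat \<Rightarrow> 'a::comm_ring_1 fps \<Rightarrow> 'a fps \<Rightarrow> bool" where
  "eq_upto N F G \<longleftrightarrow> (\<forall>n\<le>N. F $ n = G $ n)"

lemma eq_upto_refl [simp]: "eq_upto N F F"
  by (simp add: eq_upto_def)

lemma eq_upto_sym: "eq_upto N F G \<Longrightarrow> eq_upto N G F"
  by (simp add: eq_upto_def)

lemma eq_upto_trans [trans]: "eq_upto N F G \<Longrightarrow> eq_upto N G H \<Longrightarrow> eq_upto N F H"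
  by (simp add: eq_upto_def)

lemma eq_upto_mult: "eq_upto N F G \<Longrightarrow> eq_upto N F' G' \<Longrightarrow> eq_upto N (F * F') (G * G')"
  by (auto simp: eq_upto_def fps_mult_nth intro!: sum.cong)

lemma eq_upto_power: "eq_upto N F G \<Longrightarrow> eq_upto N (F ^ k) (G ^ k)"
  by (induction k) (auto intro: eq_upto_mult)

lemma eq_upto_all: "(\<And>N. eq_upto N F G) \<Longrightarrow> F = G"
  by (auto simp: eq_upto_def fps_eq_iff)

lemma eq_upto_prod_weighted_gf:
  "eq_upto N ((\<Prod>k=1..N. 1 - fps_const (w k) * fps_X ^ k) * weighted_gf w) 1"
  unfolding weighted_gf_prod_factor eq_upto_def
proof (intro allI impI)
  fix n assume "n \<le> N"
  then have "weighted_gf (\<lambda>k. if k \<le> N then 0 else w k) $ n = weighted_gf (\<lambda>_. 0) $ n" by (intro weighted_gf_cong) auto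
  then show "weighted_gf (\<lambda>k. if k \<le> N then 0 else w k) $ n = 1 $ n" by (simp add: weighted_gf_0)
qed

text \<open>\<open>two_weight c j\<close> is \<open>1 / ((1 - q) \<cdots> (1 - q\<^sup>j) \<cdot> (1 - c q\<^bsup>j+1\<^esup>) (1 - c q\<^bsup>j+2\<^esup>) \<cdots>)\<close>.\<close>

definition two_weight :: "'a::comm_ring_1 \<Rightarrow> nat \<Rightarrow> 'a fps" where
  "two_weight c j = weighted_gf (\<lambda>k. if k \<le> j then 1 else c)"

text \<open>The two series differ only in the weight of the part \<open>Suc j\<close>, and both
  sides delete that part.\<close>

lemma two_weight_Suc:
  "(1 - fps_X ^ Suc j) * two_weight c (Suc j) = (1 - fps_const c * fps_X ^ Suc j) * two_weight c j"
proof -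
  have "(1 - fps_X ^ Suc j) * two_weight c (Suc j) = weighted_gf ((\<lambda>k. if k \<le> Suc j then 1 else c)(Suc j := 0))"
    using weighted_gf_factor[of "Suc j" "\<lambda>k. if k \<le> Suc j then 1 else c"] by (simp add: two_weight_def)
  also have "\<dots> = weighted_gf ((\<lambda>k. if k \<le> j then 1 else c)(Suc j := 0))"
    by (intro weighted_gf_eqI) auto
  also have "\<dots> = (1 - fps_const c * fps_X ^ Suc j) * two_weight c j"
    using weighted_gf_factor[of "Suc j" "\<lambda>k. if k \<le> j then 1 else c"] by (simp add: two_weight_def)
  finally show ?thesis .
qed

definition qbin_part :: "'a::comm_ring_1 \<Rightarrow> 'a \<Rightarrow> nat \<Rightarrow> nat \<Rightarrow> 'a fps" where
  "qbin_part c u M i = (\<Sum>j\<le>M. fps_const (u ^ j) * fps_X ^ (i * j) * two_weight c j)"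

text \<open>For \<open>i \<ge> 1\<close> this is the sum over all \<open>j\<close>: the terms with \<open>j > n\<close> do not reach \<open>q\<^sup>n\<close>.\<close>

definition qbin :: "'a::comm_ring_1 \<Rightarrow> 'a \<Rightarrow> nat \<Rightarrow> 'a fps" where
  "qbin c u i = Abs_fps (\<lambda>n. qbin_part c u n i $ n)"

lemma qbin_eq_part:
  assumes "i \<ge> 1"
  shows "eq_upto M (qbin c u i) (qbin_part c u M i)"
proof -
  have step: "qbin_part c u (Suc M) i $ n = qbin_part c u M i $ n" if "n \<le> M" for n M
  proof -
    have "n < i * Suc M" using that assms by (metis le_imp_less_Suc mult_le_mono1 nat_mult_1 less_le_trans)
    then show ?thesis by (simp add: qbin_part_def fps_X_power_mult_nth mult.assoc del: mult_Suc_right)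
  qed
  have "qbin_part c u M i $ n = qbin_part c u n i $ n" if "n \<le> M" for n
    using that by (induction rule: dec_induct) (simp_all add: step)
  then show ?thesis by (simp add: eq_upto_def qbin_def)
qed

text \<open>Passing from i to \<open>Suc i\<close> replaces u by u q, so the j-th term of the
  difference carries \<open>1 - q^j\<close>. This kills j = 0 and lets \<open>two_weight_Suc\<close>
  lower j by one, which is why the truncation drops from \<open>Suc M\<close> to M.\<close>

lemma qbin_part_rec:
  "qbin_part c u (Suc M) i - qbin_part c u (Suc M) (Suc i) =
     fps_const u * fps_X ^ i * qbin_part c u M i - fps_const (c * u) * fps_X ^ Suc i * qbin_part c u M (Suc i)"
proof -
  have "qbin_part c u (Suc M) i - qbin_part c u (Suc M) (Suc i) =
      (\<Sum>j\<le>Suc M. fps_const (u ^ j) * fps_X ^ (i * j) * ((1 - fps_X ^ j) * two_weight c j))"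
    unfolding qbin_part_def sum_subtractf[symmetric]
    by (intro sum.cong refl) (simp add: algebra_simps power_add)
  also have "\<dots> = (\<Sum>j\<le>M. fps_const (u ^ Suc j) * fps_X ^ (i * Suc j) * ((1 - fps_X ^ Suc j) * two_weight c (Suc j)))"
    by (subst sum.atMost_Suc_shift) simp
  also have "\<dots> = (\<Sum>j\<le>M. fps_const u * fps_X ^ i * (fps_const (u ^ j) * fps_X ^ (i * j) * two_weight c j)
      - fps_const (c * u) * fps_X ^ Suc i * (fps_const (u ^ j) * fps_X ^ (Suc i * j) * two_weight c j))"
    unfolding two_weight_Suc
    by (intro sum.cong refl) (simp add: algebra_simps power_add flip: fps_const_mult)
  finally show ?thesis
    unfolding qbin_part_def sum_subtractf sum_distrib_left .
qed

lemma qbin_rec: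
  assumes "i \<ge> 1"
  shows "(1 - fps_const u * fps_X ^ i) * qbin c u i = (1 - fps_const (c * u) * fps_X ^ Suc i) * qbin c u (Suc i)"
proof (rule fps_ext)
  fix n
  have e: "qbin c u i' $ n = qbin_part c u (Suc n) i' $ n"
    "(F * qbin c u i') $ n = (F * qbin_part c u n i') $ n" if "i' \<ge> 1" for i' F
    using qbin_eq_part[OF that, of "Suc n" c u] eq_upto_mult[OF eq_upto_refl[of n F] qbin_eq_part[OF that, of n c u]]
    by (simp_all add: eq_upto_def)
  have "qbin c u i $ n - qbin c u (Suc i) $ n =
    (fps_const u * fps_X ^ i * qbin c u i - fps_const (c * u) * fps_X ^ Suc i * qbin c u (Suc i)) $ n"
    using arg_cong[OF qbin_part_rec[of c u n i], of "\<lambda>F. F $ n"] e(1)[OF assms] e(1)[of "Suc i"]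
      e(2)[OF assms] e(2)[of "Suc i"] by (simp only: fps_sub_nth)
  then show "((1 - fps_const u * fps_X ^ i) * qbin c u i) $ n =
      ((1 - fps_const (c * u) * fps_X ^ Suc i) * qbin c u (Suc i)) $ n"
    unfolding left_diff_distrib fps_sub_nth mult_1_left by (simp only: algebra_simps)
qed

lemma qbin_prod:
  "(\<Prod>k=1..N. 1 - fps_const u * fps_X ^ k) * qbin c u 1 =
   (\<Prod>k=1..N. 1 - fps_const (c * u) * fps_X ^ Suc k) * qbin c u (Suc N)"
proof (induction N)
  case (Suc N)
  have "(\<Prod>k=1..Suc N. 1 - fps_const u * fps_X ^ k) * qbin c u 1 =
      (1 - fps_const u * fps_X ^ Suc N) * ((\<Prod>k=1..N. 1 - fps_const u * fps_X ^ k) * qbin c u 1)"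
    by (simp add: ac_simps)
  also have "\<dots> = (\<Prod>k=1..N. 1 - fps_const (c * u) * fps_X ^ Suc k) *
      ((1 - fps_const u * fps_X ^ Suc N) * qbin c u (Suc N))"
    unfolding Suc by (simp add: ac_simps)
  also have "\<dots> = (\<Prod>k=1..Suc N. 1 - fps_const (c * u) * fps_X ^ Suc k) * qbin c u (Suc (Suc N))"
    by (subst qbin_rec) (simp_all add: ac_simps)
  finally show ?case .
qed simp

lemma qbin_large:
  "eq_upto N (qbin c u (Suc N)) (weighted_gf (\<lambda>_. c))"
proof -
  have "(\<Sum>j\<le>N. fps_const (u ^ j) * fps_X ^ (Suc N * j) * two_weight c j) $ n = weighted_gf (\<lambda>_. c) $ n"
    if "n \<le> N" for n
  proof -
    have "(fps_const (u ^ Suc j) * fps_X ^ (Suc N * Suc j) * two_weight c (Suc j)) $ n = 0" for j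
    proof -
      have "n < Suc N * Suc j" using that by simp
      then show ?thesis by (simp add: fps_X_power_mult_nth mult.assoc del: mult_Suc mult_Suc_right)
    qed
    moreover have "two_weight c 0 $ n = weighted_gf (\<lambda>_. c) $ n"
      unfolding two_weight_def by (intro weighted_gf_cong) auto
    ultimately show ?thesis
      by (cases N) (simp_all add: sum.atMost_Suc_shift fps_sum_nth del: sum.atMost_Suc mult_Suc mult_Suc_right power_Suc)
  qed
  then show ?thesis
    using qbin_eq_part[of "Suc N" N c u] by (simp add: eq_upto_def qbin_part_def)
qed

text \<open>The identity \<open>\<Sum>j. (a)_j / (q)_j * t^j = (a t)_\<infinity> /
  (t)_\<infinity>\<close> with a = c q and t = u q, divided by \<open>(c q)_\<infinity>\<close>.
  Iterating \<open>qbin_rec\<close> pushes i beyond N, where only the term j = 0 reaches order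
  N.\<close>

lemma qbinomial_theorem:
  "eq_upto N (qbin c u 1)
    (weighted_gf (\<lambda>_. u) * weighted_gf (\<lambda>_. c) * (\<Prod>k=1..N. 1 - fps_const (c * u) * fps_X ^ Suc k))"
proof -
  let ?P = "\<Prod>k=1..N. 1 - fps_const u * fps_X ^ k"
  let ?Q = "\<Prod>k=1..N. 1 - fps_const (c * u) * fps_X ^ Suc k"
  have "eq_upto N (1 * qbin c u 1) (?P * weighted_gf (\<lambda>_. u) * qbin c u 1)"
    by (intro eq_upto_mult eq_upto_refl eq_upto_sym[OF eq_upto_prod_weighted_gf])
  also have "?P * weighted_gf (\<lambda>_. u) * qbin c u 1 = weighted_gf (\<lambda>_. u) * (?Q * qbin c u (Suc N))"
    unfolding qbin_prod[symmetric] by (simp add: ac_simps)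
  also have "eq_upto N \<dots> (weighted_gf (\<lambda>_. u) * (?Q * weighted_gf (\<lambda>_. c)))"
    by (intro eq_upto_mult eq_upto_refl qbin_large)
  finally show ?thesis by (simp add: ac_simps)
qed

lemma qbin_0_left: "qbin 0 u 1 = weighted_gf (\<lambda>_. u)"
  using qbinomial_theorem[of _ "0::'a" u] by (intro eq_upto_all) (simp add: weighted_gf_0)

text \<open>For c u = 1 the numerator is \<open>(1 - q^2) (1 - q^3) \<cdots>\<close>; the prefactor
  1 - q completes it to \<open>(q)_\<infinity>\<close>, which
  \<open>weighted_gf (\<lambda>_. 1)\<close> cancels.\<close>

lemma qbin_inverse:
  assumes "c * u = 1"
  shows "(1 - fps_X) * qbin c u 1 * weighted_gf (\<lambda>_. 1) = weighted_gf (\<lambda>_. c) * weighted_gf (\<lambda>_. u)"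
proof (rule eq_upto_all)
  fix N
  let ?Q = "\<Prod>k=1..N. 1 - fps_X ^ Suc k :: 'a fps"
  have *: "(1 - fps_X) * ?Q = (\<Prod>k=1..Suc N. 1 - fps_const 1 * fps_X ^ k)"
  proof -
    have "(\<Prod>k=1..Suc N. 1 - fps_X ^ k :: 'a fps) = (1 - fps_X ^ 1) * (\<Prod>k=Suc 1..Suc N. 1 - fps_X ^ k)"
      by (rule prod.atLeast_Suc_atMost) simp
    also have "(\<Prod>k=Suc 1..Suc N. 1 - fps_X ^ k :: 'a fps) = ?Q"
      by (rule prod.shift_bounds_cl_Suc_ivl)
    finally show ?thesis by (simp only: fps_const_1_eq_1 mult_1 power_one_right)
  qed
  have "eq_upto N ((1 - fps_X) * qbin c u 1 * weighted_gf (\<lambda>_. 1)) 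
      ((1 - fps_X) * (weighted_gf (\<lambda>_. u) * weighted_gf (\<lambda>_. c) * ?Q) * weighted_gf (\<lambda>_. 1))"
    using qbinomial_theorem[of N c u] assms by (intro eq_upto_mult eq_upto_refl) simp
  also have "\<dots> = weighted_gf (\<lambda>_. u) * weighted_gf (\<lambda>_. c) * ((1 - fps_X) * ?Q * weighted_gf (\<lambda>_. 1))"
    by (simp only: ac_simps)
  also have "eq_upto N \<dots> (weighted_gf (\<lambda>_. u) * weighted_gf (\<lambda>_. c) * 1)"
    unfolding * using eq_upto_prod_weighted_gf[of "Suc N" "\<lambda>_. 1::'a"]
    by (intro eq_upto_mult eq_upto_refl) (simp add: eq_upto_def)
  finally show "eq_upto N ((1 - fps_X) * qbin c u 1 * weighted_gf (\<lambda>_. 1)) (weighted_gf (\<lambda>_. c) * weighted_gf (\<lambda>_. u))"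
    by (simp add: ac_simps)
qed

subsection \<open>The crank\<close>

lemma weighted_gf_upd_0_nth:
  "weighted_gf (w(k := 0)) $ n = (\<Sum>p\<in>{p \<in> partitions_of n. k \<notin># p}. \<Prod>i\<in>#p. w i)"
proof -
  have "(\<Sum>p\<in>partitions_of n. \<Prod>i\<in>#p. (w(k := 0)) i) =
      (\<Sum>p\<in>{p \<in> partitions_of n. k \<notin># p}. \<Prod>i\<in>#p. (w(k := 0)) i)"
    by (intro sum.mono_neutral_right) (auto simp: finite_partitions_of intro: prod_mset_eq_0_if[of k])
  also have "\<dots> = (\<Sum>p\<in>{p \<in> partitions_of n. k \<notin># p}. \<Prod>i\<in>#p. w i)"
    by (intro sum.cong refl prod_mset_fun_cong) auto
  finally show ?thesis by (simp only: weighted_gf_nth)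
qed

lemma one_minus_X_two_weight:
  assumes "j \<ge> 1"
  shows "((1 - fps_X) * two_weight c j) $ n =
    (\<Sum>p\<in>{p \<in> partitions_of n. 1 \<notin># p}. \<Prod>i\<in>#p. if i \<le> j then 1 else c)"
  using weighted_gf_factor[of 1 "\<lambda>k. if k \<le> j then 1 else c"] assms
  by (simp add: two_weight_def flip: weighted_gf_upd_0_nth)

lemma prod_mset_two_weight:
  fixes j :: nat and c :: "'a::comm_ring_1"
  shows "(\<Prod>i\<in>#p. if i \<le> j then 1 else c) = c ^ size {#i \<in># p. i > j#}"
  by (induction p) auto

lemma partitions_with_count_one:
  assumes "j \<ge> 1"
  shows "{p \<in> partitions_of n. count p 1 = j} =
    (if n < j then {} else (\<lambda>q. q + replicate_mset j 1) ` {q \<in> partitions_of (n - j). 1 \<notin># q})"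
proof -
  have mem: "p \<in> (\<lambda>q. q + replicate_mset j 1) ` {q \<in> partitions_of (n - j). 1 \<notin># q} \<and> \<not> n < j"
    if p: "p \<in> partitions_of n" "count p 1 = j" for p
  proof -
    define q where "q = filter_mset (\<lambda>k. k \<noteq> 1) p"
    have pq: "p = q + replicate_mset j 1"
      using p(2) by (simp add: q_def multiset_eq_iff)
    have "1 \<notin># q" by (simp add: q_def)
    moreover have "sum_mset q + j = n" "0 \<notin># q" using p(1) pq by (auto simp: partitions_of_def)
    ultimately show ?thesis using pq by (auto simp: partitions_of_def)
  qed
  show ?thesis
  proof (cases "n < j")
    case True
    then show ?thesis using mem by (simp only: if_True) blast
  next
    case False
    have "{p \<in> partitions_of n. count p 1 = j} \<subseteq> (\<lambda>q. q + replicate_mset j 1) ` {q \<in> partitions_of (n - j). 1 \<notin># q}"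
      using mem by blast
    moreover have "q + replicate_mset j 1 \<in> {p \<in> partitions_of n. count p 1 = j}"
      if "q \<in> partitions_of (n - j)" "1 \<notin># q" for q
      using that False by (auto simp: partitions_of_def not_in_iff)
    ultimately show ?thesis using False by auto
  qed
qed

text \<open>The j ones contribute \<open>(q / z)^j\<close>. Any other part has weight z if it
  exceeds j and 1 if not, as in \<open>two_weight z j\<close>; the factor 1 - q keeps further ones
  out.\<close>

lemma sum_crank_count_one:
  fixes z :: "'a::field"
  assumes "j \<ge> 1" "z \<noteq> 0"
  shows "(\<Sum>p\<in>{p \<in> partitions_of n. count p 1 = j}. z powi partition_crank p) =
    (fps_const ((1 / z) ^ j) * fps_X ^ (1 * j) * ((1 - fps_X) * two_weight z j)) $ n"
proof (cases "n < j")
  case True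
  then have A: "{p \<in> partitions_of n. count p 1 = j} = {}"
    using partitions_with_count_one[OF assms(1), of n] by simp
  show ?thesis unfolding A using True by (simp add: fps_X_power_mult_nth mult.assoc)
next
  case False
  then have A: "{p \<in> partitions_of n. count p 1 = j} =
      (\<lambda>q. q + replicate_mset j 1) ` {q \<in> partitions_of (n - j). 1 \<notin># q}"
    using partitions_with_count_one[OF assms(1), of n] by simp
  have "z powi partition_crank (q + replicate_mset j 1) =
      (1 / z) ^ j * (\<Prod>i\<in>#q. if i \<le> j then 1 else z)" if "1 \<notin># q" for q
  proof -
    have "count (q + replicate_mset j 1) 1 = j" using that by (simp add: not_in_iff)
    moreover have "filter_mset (\<lambda>i. i > j) (q + replicate_mset j 1) = filter_mset (\<lambda>i. i > j) q"
      using assms(1) by (auto simp: filter_mset_eq_mempty_iff)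
    ultimately have "partition_crank (q + replicate_mset j 1) = int (size {#i \<in># q. i > j#}) - int j"
      using assms(1) by (auto simp: partition_crank_def not_in_iff)
    then show ?thesis
      using assms(2) by (simp add: prod_mset_two_weight power_int_diff power_one_over)
  qed
  then have "(\<Sum>p\<in>{p \<in> partitions_of n. count p 1 = j}. z powi partition_crank p) =
      (1 / z) ^ j * ((1 - fps_X) * two_weight z j) $ (n - j)"
    unfolding A one_minus_X_two_weight[OF assms(1)] sum_distrib_left
    by (subst sum.reindex) (auto simp: inj_on_def intro!: sum.cong)
  then show ?thesis using False by (simp add: fps_X_power_mult_nth mult.assoc)
qed

lemma partitions_with_Max:
  assumes "n \<ge> 2" "k \<ge> 2"
  shows "{p \<in> partitions_of n. 1 \<notin># p \<and> Max (set_mset p) = k} =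
    (if n < k then {} else add_mset k ` {q \<in> partitions_of (n - k). 1 \<notin># q \<and> (\<forall>i\<in>#q. i \<le> k)})"
proof -
  have "p \<in> add_mset k ` {q \<in> partitions_of (n - k). 1 \<notin># q \<and> (\<forall>i\<in>#q. i \<le> k)} \<and> \<not> n < k"
    if p: "p \<in> partitions_of n" "1 \<notin># p" "Max (set_mset p) = k" for p
  proof -
    have "p \<noteq> {#}" using p(1) assms by (intro partitions_of_nonempty) auto
    then have "k \<in># p" "\<forall>i\<in>#p. i \<le> k" using p(3) by (auto intro: Max_in)
    moreover from this obtain q where "p = add_mset k q" by (metis mset_add)
    ultimately show ?thesis using p(1,2) by (auto simp: partitions_of_def)
  qed
  moreover have "Max (insert k (set_mset q)) = k" if "\<forall>i\<in>#q. i \<le> k" for q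
    using that by (intro Max_eqI) auto
  ultimately show ?thesis using assms by (auto simp: partitions_of_def)
qed

text \<open>Deleting one largest part k leaves parts from 2 to k; the weight 0 in
  \<open>two_weight 0 k\<close> forbids larger ones.\<close>

lemma sum_Max_no_ones:
  fixes z :: "'a::field"
  assumes "n \<ge> 2"
  shows "(\<Sum>p\<in>{p \<in> partitions_of n. 1 \<notin># p \<and> Max (set_mset p) = k}. z ^ Max (set_mset p)) =
    (fps_const (z ^ k) * fps_X ^ (1 * k) * ((1 - fps_X) * two_weight 0 k)) $ n"
proof -
  consider "k = 0" | "k = 1" | "k \<ge> 2" "n < k" | "k \<ge> 2" "k \<le> n" by linarith
  then show ?thesis
  proof cases
    \<comment> \<open>For k = 0 and k = 1 the right-hand series are 1 - q and z q, so nothing is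
      left from \<open>q^2\<close> on.\<close>
    case 1
    have "two_weight (0 :: 'a) 0 = 1"
      unfolding two_weight_def weighted_gf_0[symmetric] by (intro weighted_gf_eqI) simp
    moreover have "Max (set_mset p) \<noteq> 0" if p: "p \<in> partitions_of n" for p
    proof -
      have "Max (set_mset p) \<in># p" using partitions_of_nonempty[OF p] assms by (intro Max_in) auto
      then show ?thesis using p by (metis (mono_tags, lifting) partitions_of_def mem_Collect_eq)
    qed
    then have A: "{p \<in> partitions_of n. 1 \<notin># p \<and> Max (set_mset p) = k} = {}" using 1 by auto
    ultimately show ?thesis unfolding A using 1 assms by (simp add: fps_X_nth)
  next
    case 2
    have "(1 - fps_X) * two_weight (0 :: 'a) 1 = 1"
      using weighted_gf_factor[of 1 "\<lambda>k. if k \<le> 1 then 1 else (0 :: 'a)"]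
        weighted_gf_eqI[of "(\<lambda>k. if k \<le> 1 then 1 else (0 :: 'a))(1 := 0)" "\<lambda>_. 0"]
      by (simp add: two_weight_def weighted_gf_0)
    moreover have "Max (set_mset p) \<noteq> 1" if p: "p \<in> partitions_of n" "1 \<notin># p" for p
    proof -
      have "Max (set_mset p) \<in># p" using partitions_of_nonempty[OF p(1)] assms by (intro Max_in) auto
      then show ?thesis using p by metis
    qed
    then have A: "{p \<in> partitions_of n. 1 \<notin># p \<and> Max (set_mset p) = k} = {}" using 2 by auto
    ultimately show ?thesis unfolding A using 2 assms by (simp add: fps_X_nth)
  next
    case 3
    then have A: "{p \<in> partitions_of n. 1 \<notin># p \<and> Max (set_mset p) = k} = {}"
      using partitions_with_Max[OF assms 3(1)] by simp
    show ?thesis unfolding A using 3 by (simp add: fps_X_power_mult_nth mult.assoc)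
  next
    case 4
    let ?B = "{q \<in> partitions_of (n - k). 1 \<notin># q \<and> (\<forall>i\<in>#q. i \<le> k)}"
    have "((1 - fps_X) * two_weight 0 k) $ (n - k) =
        (\<Sum>p\<in>{p \<in> partitions_of (n - k). 1 \<notin># p}. \<Prod>i\<in>#p. if i \<le> k then 1 else (0 :: 'a))"
      using 4 by (intro one_minus_X_two_weight) simp
    also have "\<dots> = (\<Sum>p\<in>?B. \<Prod>i\<in>#p. if i \<le> k then 1 else (0 :: 'a))"
      by (intro sum.mono_neutral_right) (auto simp: finite_partitions_of intro: prod_mset_eq_0_if)
    also have "\<dots> = (\<Sum>p\<in>?B. 1)"
    proof (intro sum.cong refl)
      fix p assume "p \<in> ?B"
      then have "{#i \<in># p. i > k#} = {#}" by auto
      then show "(\<Prod>i\<in>#p. if i \<le> k then 1 else (0 :: 'a)) = 1"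
        by (simp only: prod_mset_two_weight size_empty power_0)
    qed
    finally have B: "((1 - fps_X) * two_weight (0 :: 'a) k) $ (n - k) = (\<Sum>p\<in>?B. 1)" .
    have A: "{p \<in> partitions_of n. 1 \<notin># p \<and> Max (set_mset p) = k} = add_mset k ` ?B"
      using partitions_with_Max[OF assms 4(1)] 4 by simp
    have "(\<Sum>p\<in>{p \<in> partitions_of n. 1 \<notin># p \<and> Max (set_mset p) = k}. z ^ Max (set_mset p)) =
        (\<Sum>p\<in>{p \<in> partitions_of n. 1 \<notin># p \<and> Max (set_mset p) = k}. z ^ k)"
      by (intro sum.cong refl) auto
    also have "\<dots> = z ^ k * ((1 - fps_X) * two_weight (0 :: 'a) k) $ (n - k)"
      unfolding A B by (subst sum.reindex) (auto simp: inj_on_def)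
    finally show ?thesis using 4 by (simp add: fps_X_power_mult_nth mult.assoc)
  qed
qed

lemma qbin_nth:
  "((1 - fps_X) * qbin c u 1) $ n =
    (\<Sum>j\<le>n. (fps_const (u ^ j) * fps_X ^ (1 * j) * ((1 - fps_X) * two_weight c j)) $ n)"
proof -
  have "((1 - fps_X) * qbin c u 1) $ n = ((1 - fps_X) * qbin_part c u n 1) $ n"
    using eq_upto_mult[OF eq_upto_refl qbin_eq_part[of 1 n c u]] by (simp add: eq_upto_def)
  also have "(1 - fps_X) * qbin_part c u n 1 =
      (\<Sum>j\<le>n. fps_const (u ^ j) * fps_X ^ (1 * j) * ((1 - fps_X) * two_weight c j))"
    unfolding qbin_part_def sum_distrib_left by (simp only: ac_simps)
  finally show ?thesis by (simp only: fps_sum_nth)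
qed

text \<open>Partitions are sorted by their number j of ones. The class j = 0, where the crank is the
  largest part, looks different, but its sum over the largest part is the case c = 0 of the
  q-binomial theorem and collapses to \<open>(1 - q) * two_weight z 0\<close>, the missing term j =
  0 of the same series.\<close>

lemma sum_crank:
  fixes z :: "'a::field"
  assumes "n \<ge> 2" "z \<noteq> 0"
  shows "(\<Sum>p\<in>partitions_of n. z powi partition_crank p) = ((1 - fps_X) * qbin z (1 / z) 1) $ n"
proof -
  let ?P = "\<lambda>j. {p \<in> partitions_of n. count p 1 = j}"
  let ?h = "\<lambda>p. z powi partition_crank p"
  let ?t = "\<lambda>j. (fps_const ((1 / z) ^ j) * fps_X ^ (1 * j) * ((1 - fps_X) * two_weight z j)) $ n"
  let ?Q = "{p \<in> partitions_of n. 1 \<notin># p}"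
  have le: "count p 1 \<le> n" if "p \<in> partitions_of n" for p
    using partitions_of_bounds(1)[OF that] count_le_size[of p 1] by linarith
  have P0: "?P 0 = ?Q" by (simp add: not_in_iff)
  have "(\<Sum>p\<in>?Q. ?h p) = (\<Sum>p\<in>?Q. z ^ Max (set_mset p))"
    by (intro sum.cong refl) (simp add: partition_crank_def)
  also have "\<dots> = (\<Sum>k\<le>n. \<Sum>p\<in>{p \<in> ?Q. Max (set_mset p) = k}. z ^ Max (set_mset p))"
    using Max_partitions_of_le[of _ n] assms by (intro sum.group[symmetric]) (auto simp: finite_partitions_of)
  also have "\<dots> = (\<Sum>k\<le>n. (fps_const (z ^ k) * fps_X ^ (1 * k) * ((1 - fps_X) * two_weight 0 k)) $ n)"
    using sum_Max_no_ones[OF assms(1), of z] by (intro sum.cong refl) (simp only: mem_Collect_eq conj_assoc)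
  also have "\<dots> = ((1 - fps_X) * weighted_gf (\<lambda>_. z)) $ n"
    unfolding qbin_nth[symmetric] qbin_0_left ..
  also have "weighted_gf (\<lambda>_. z) = two_weight z 0"
    unfolding two_weight_def by (intro weighted_gf_eqI) simp
  finally have j0: "(\<Sum>p\<in>?P 0. ?h p) = ?t 0" unfolding P0 by simp
  have "(\<Sum>p\<in>partitions_of n. ?h p) = (\<Sum>j\<le>n. \<Sum>p\<in>?P j. ?h p)"
    using le by (intro sum.group[symmetric]) (auto simp: finite_partitions_of)
  also have "\<dots> = (\<Sum>j\<le>n. ?t j)"
  proof (intro sum.cong refl)
    fix j show "(\<Sum>p\<in>?P j. ?h p) = ?t j"
      using j0 sum_crank_count_one[of j z n] assms(2) by (cases "j = 0") auto
  qed
  finally show ?thesis unfolding qbin_nth .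
qed

lemma C_gf_eq_qbin: "C_gf = (1 - fps_X) * qbin zvar (1 / zvar) 1"
proof (rule fps_ext)
  fix n :: nat
  consider "n = 0" | "n = 1" | "n \<ge> 2" by linarith
  then show "C_gf $ n = ((1 - fps_X) * qbin zvar (1 / zvar) 1) $ n"
  proof cases
    case 1
    then show ?thesis
      by (simp add: C_gf_def M_crank_def qbin_def qbin_part_def two_weight_def weighted_gf_nth partitions_of_0)
  next
    \<comment> \<open>The series has the coefficient z - 1 + 1/z at q, which is what the
      conventional values of \<open>M_crank\<close> at n = 1 encode.\<close>
    case 2
    have "partitions_of 1 = {{#1#}}"
    proof -
      have "1 \<in># p" if p: "p \<in> partitions_of 1" for p
      proof -
        obtain k where k: "k \<in># p" using partitions_of_nonempty[OF p] by auto
        moreover have "k \<le> 1" using p k by (rule partitions_of_bounds)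
        moreover have "k \<noteq> 0" using p k by (metis (mono_tags, lifting) partitions_of_def mem_Collect_eq)
        ultimately show ?thesis by (cases k) auto
      qed
      then have "partitions_of 1 = {p \<in> partitions_of 1. 1 \<in># p}" by blast
      then show ?thesis by (simp add: partitions_of_containing partitions_of_0)
    qed
    moreover have "{- 1..1} = {-1, 0, 1 :: int}" by auto
    ultimately show ?thesis using 2
      by (simp add: C_gf_def M_crank_def qbin_def qbin_part_def two_weight_def weighted_gf_nth partitions_of_0
          left_diff_distrib power_int_minus inverse_eq_divide)
  next
    case 3
    have r: "partition_crank ` partitions_of n \<subseteq> {- int n..int n}"
    proof
      fix m assume "m \<in> partition_crank ` partitions_of n"
      then have "{p \<in> partitions_of n. partition_crank p = m} \<noteq> {}" by auto
      then have "card {p \<in> partitions_of n. partition_crank p = m} \<noteq> 0" by (simp add: finite_partitions_of)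
      then have "M_crank m n \<noteq> 0" using 3 by (simp add: M_crank_def)
      then show "m \<in> {- int n..int n}" using M_crank_eq_0 by metis
    qed
    have "C_gf $ n = (\<Sum>m = - int n..int n. of_nat (card {p \<in> partitions_of n. partition_crank p = m}) * zvar powi m)"
      using 3 by (simp add: C_gf_def M_crank_def)
    also have "\<dots> = (\<Sum>m = - int n..int n. \<Sum>p\<in>{p \<in> partitions_of n. partition_crank p = m}. zvar powi partition_crank p)"
      by (intro sum.cong refl) simp
    also have "\<dots> = (\<Sum>p\<in>partitions_of n. zvar powi partition_crank p)"
      by (intro sum.group r) (auto simp: finite_partitions_of)
    also have "\<dots> = ((1 - fps_X) * qbin zvar (1 / zvar) 1) $ n"
      using 3 zvar_neq_0 by (rule sum_crank)
    finally show ?thesis .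
  qed
qed

lemma C_gf_product: "C_gf * weighted_gf (\<lambda>_. 1) = weighted_gf (\<lambda>_. zvar) * weighted_gf (\<lambda>_. 1 / zvar)"
  unfolding C_gf_eq_qbin using zvar_neq_0 by (intro qbin_inverse) simp

subsection \<open>Functional equations of two-variable arrays\<close>

text \<open>
  An array \<open>v\<close> stands for the formal sum of the terms \<open>v m n z\<^sup>m q\<^sup>n\<close>. On arrays, \<open>binom_op i j\<close> is
  multiplication by \<open>1 - z\<^sup>i q\<^sup>j\<close>, \<open>subst_q\<close> replaces \<open>z\<close> by \<open>zq\<close>, \<open>neg_shift\<close> multiplies by \<open>- 1 / z\<close>,
  and \<open>theta_op N\<close> multiplies by \<open>(1 - z q\<^sup>k) (1 - q\<^sup>k / z)\<close> for all \<open>k\<close> from \<open>1\<close> to \<open>N\<close>. Arrays need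
  not be Laurent polynomials in \<open>z\<close> for fixed \<open>n\<close>, so the two expansions of \<open>1 / (1 - z)\<close> are available.
\<close>

definition binom_op :: "int \<Rightarrow> int \<Rightarrow> (int \<Rightarrow> int \<Rightarrow> 'a::field) \<Rightarrow> int \<Rightarrow> int \<Rightarrow> 'a" where
  "binom_op i j v = (\<lambda>m n. v m n - v (m - i) (n - j))"

definition subst_q :: "(int \<Rightarrow> int \<Rightarrow> 'a::field) \<Rightarrow> int \<Rightarrow> int \<Rightarrow> 'a" where
  "subst_q v = (\<lambda>m n. v m (n - m))"

definition neg_shift :: "(int \<Rightarrow> int \<Rightarrow> 'a::field) \<Rightarrow> int \<Rightarrow> int \<Rightarrow> 'a" where
  "neg_shift v = (\<lambda>m n. - v (m + 1) n)"

primrec theta_op :: "nat \<Rightarrow> (int \<Rightarrow> int \<Rightarrow> 'a::field) \<Rightarrow> int \<Rightarrow> int \<Rightarrow> 'a" where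
  "theta_op 0 v = v"
| "theta_op (Suc N) v = binom_op 1 (int N + 1) (binom_op (-1) (int N + 1) (theta_op N v))"

lemma binom_op_commute: "binom_op i j (binom_op i' j' v) = binom_op i' j' (binom_op i j v)"
  by (simp add: binom_op_def fun_eq_iff algebra_simps)

lemma subst_q_binom_op: "subst_q (binom_op i j v) = binom_op i (j + i) (subst_q v)"
  by (simp add: binom_op_def subst_q_def fun_eq_iff algebra_simps)

lemma binom_op_neg_shift: "binom_op i j (neg_shift v) = neg_shift (binom_op i j v)"
  by (simp add: binom_op_def neg_shift_def fun_eq_iff algebra_simps)

lemma binom_op_minus_1_0: "binom_op (-1) 0 v = neg_shift (binom_op 1 0 v)"
  by (simp add: binom_op_def neg_shift_def fun_eq_iff)

lemma theta_op_binom_op: "theta_op N (binom_op i j v) = binom_op i j (theta_op N v)"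
proof (induction N)
  case (Suc N)
  have "theta_op (Suc N) (binom_op i j v) = binom_op 1 (int N + 1) (binom_op i j (binom_op (-1) (int N + 1) (theta_op N v)))"
    unfolding theta_op.simps Suc by (subst (2) binom_op_commute) (rule refl)
  also have "\<dots> = binom_op i j (theta_op (Suc N) v)"
    unfolding theta_op.simps by (rule binom_op_commute)
  finally show ?case .
qed simp

lemma theta_op_neg_shift: "theta_op N (neg_shift v) = neg_shift (theta_op N v)"
  by (induction N) (simp_all add: binom_op_neg_shift)

definition full_theta :: "nat \<Rightarrow> (int \<Rightarrow> int \<Rightarrow> 'a::field) \<Rightarrow> int \<Rightarrow> int \<Rightarrow> 'a" where
  "full_theta N v = binom_op 1 0 (theta_op N v)"

lemma full_theta_binom_op: "full_theta N (binom_op i j v) = binom_op i j (full_theta N v)"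
  unfolding full_theta_def theta_op_binom_op by (rule binom_op_commute)

lemma full_theta_neg_shift: "full_theta N (neg_shift v) = neg_shift (full_theta N v)"
  unfolding full_theta_def theta_op_neg_shift binom_op_neg_shift ..

text \<open>The substitution moves each factor to its neighbour, and
  \<open>1 - 1/z = - (1 - z) / z\<close>. The end factors \<open>1 - q^N / z\<close> and
  \<open>1 - z q^(N+1)\<close> are the price of truncation; in the limit the law is multiplication
  by -1/z.\<close>

lemma subst_q_full_theta:
  "binom_op (-1) N (subst_q (full_theta N v)) = neg_shift (binom_op 1 (int N + 1) (full_theta N (subst_q v)))"
proof (induction N)
  case 0
  show ?case
    by (simp add: full_theta_def subst_q_binom_op binom_op_minus_1_0 binom_op_commute[of 1 1])
next
  case (Suc N)
  let ?B = "binom_op (-1) (int (Suc N))" and ?F = "binom_op 1 (int (Suc N) + 1)"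
  let ?C = "binom_op (-1) (int N)" and ?G = "binom_op 1 (int N + 1)"
  have step: "full_theta (Suc N) w = ?G (?B (full_theta N w))" for w :: "int \<Rightarrow> int \<Rightarrow> 'a"
    unfolding full_theta_def theta_op.simps
    by (simp only: binom_op_commute[of 1 0] of_nat_Suc add.commute[of 1])
  have "subst_q (full_theta (Suc N) v) = ?F (?C (subst_q (full_theta N v)))"
    unfolding step subst_q_binom_op by (simp add: algebra_simps)
  also have "\<dots> = neg_shift (?F (?G (full_theta N (subst_q v))))"
    unfolding Suc binom_op_neg_shift ..
  finally have "?B (subst_q (full_theta (Suc N) v)) = neg_shift (?F (?G (?B (full_theta N (subst_q v)))))"
    by (simp only: binom_op_neg_shift binom_op_commute[of "-1"])
  then show ?case unfolding step .
qed

text \<open>\<open>v\<close> and \<open>w\<close> are meant as two expansions of one function,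
  different as arrays but with the same product V with the cube, because the cube contains
  \<open>(1 - z)^3\<close>.\<close>

lemma full_theta_cube_functional_eq:
  assumes "subst_q v = (\<lambda>m n. - w (m - 3) (n - 1))"
    and "V = full_theta N (full_theta N (full_theta N v))"
    and "V = full_theta N (full_theta N (full_theta N w))"
  shows "binom_op (-1) N (binom_op (-1) N (binom_op (-1) N (subst_q V))) =
    (\<lambda>m n. binom_op 1 (int N + 1) (binom_op 1 (int N + 1) (binom_op 1 (int N + 1) V)) m (n - 1))"
proof -
  let ?B = "binom_op (-1) (int N)" and ?F = "binom_op 1 (int N + 1)" and ?T = "full_theta N"
  have BT: "?B (subst_q (?T u)) = neg_shift (?F (?T (subst_q u)))" for u :: "int \<Rightarrow> int \<Rightarrow> 'a"
    by (rule subst_q_full_theta)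
  have "?B (?B (?B (subst_q V))) =
      neg_shift (?F (?T (neg_shift (?F (?T (neg_shift (?F (?T (subst_q v)))))))))"
    unfolding assms(2) by (simp only: BT binom_op_neg_shift binom_op_commute[of "-1" _ 1] full_theta_binom_op[symmetric, of "-1"])
  also have "\<dots> = neg_shift (neg_shift (neg_shift (?F (?F (?F (?T (?T (?T (subst_q v)))))))))"
    by (simp only: binom_op_neg_shift full_theta_neg_shift full_theta_binom_op)
  also have "\<dots> = ?F (?F (?F (?T (?T (?T (neg_shift (neg_shift (neg_shift (subst_q v)))))))))"
    by (simp only: binom_op_neg_shift full_theta_neg_shift)
  \<comment> \<open>Three factors -1/z cancel the multiplier \<open>- z^3\<close> and leave
    q.\<close>
  also have "neg_shift (neg_shift (neg_shift (subst_q v))) = (\<lambda>m n. w m (n - 1))"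
    unfolding assms(1) by (simp add: neg_shift_def)
  finally have *: "?B (?B (?B (subst_q V))) = ?F (?F (?F (?T (?T (?T (\<lambda>m n. w m (n - 1)))))))" .
  have sh: "binom_op i j (\<lambda>m n. u m (n - 1)) = (\<lambda>m n. binom_op i j u m (n - 1))" for i j and u :: "int \<Rightarrow> int \<Rightarrow> 'a"
    by (simp add: binom_op_def fun_eq_iff algebra_simps)
  have sh': "?T (\<lambda>m n. u m (n - 1)) = (\<lambda>m n. ?T u m (n - 1))" for u :: "int \<Rightarrow> int \<Rightarrow> 'a"
  proof -
    have "theta_op M (\<lambda>m n. u m (n - 1)) = (\<lambda>m n. theta_op M u m (n - 1))" for M
      by (induction M) (simp_all add: sh)
    then show ?thesis by (simp add: full_theta_def sh)
  qed
  have "?F (?F (?F (?T (?T (?T (\<lambda>m n. w m (n - 1))))))) = (\<lambda>m n. ?F (?F (?F V)) m (n - 1))"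
    unfolding assms(3) by (simp only: sh sh')
  then show ?thesis unfolding * .
qed

lemma binom_op_eq_upto:
  assumes "\<And>m n. n < 0 \<Longrightarrow> v m n = 0" "n < j"
  shows "binom_op i j v m n = v m n"
  using assms by (simp add: binom_op_def)

text \<open>Up to order \<open>N\<close> in \<open>q\<close> the equation reads \<open>V(zq) = q V(z)\<close>.\<close>

lemma coeff_recurrence:
  fixes V :: "int \<Rightarrow> int \<Rightarrow> 'a::field"
  assumes neg: "\<And>m n. n < 0 \<Longrightarrow> V m n = 0"
    and eq: "binom_op (-1) N (binom_op (-1) N (binom_op (-1) N (subst_q V))) =
      (\<lambda>m n. binom_op 1 (int N + 1) (binom_op 1 (int N + 1) (binom_op 1 (int N + 1) V)) m (n - 1))"
    and l: "l \<le> int N" "l + m - 1 \<le> int N"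
  shows "V m l = V m (l + m - 1)"
proof -
  \<comment> \<open>Pulled inside the substitution, \<open>1 - q^N / z\<close> becomes
    \<open>1 - q^(N+1) / z\<close>, which does not affect orders up to N.\<close>
  have 1: "subst_q (binom_op (-1) (int N + 1) u) = binom_op (-1) N (subst_q u)" for u :: "int \<Rightarrow> int \<Rightarrow> 'a"
    by (simp add: subst_q_binom_op)
  have neg': "binom_op i (int N + 1) u m n = 0" if "\<And>m n. n < 0 \<Longrightarrow> u m n = 0" "n < 0"
    for i m n and u :: "int \<Rightarrow> int \<Rightarrow> 'a"
    using that by (simp add: binom_op_def)
  have cube: "binom_op i (int N + 1) (binom_op i (int N + 1) (binom_op i (int N + 1) V)) m n = V m n"
    if "n \<le> int N" for i m n
    using that neg by (simp add: binom_op_eq_upto neg')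
  have "subst_q (binom_op (-1) (int N + 1) (binom_op (-1) (int N + 1) (binom_op (-1) (int N + 1) V))) m (l + m) =
      binom_op 1 (int N + 1) (binom_op 1 (int N + 1) (binom_op 1 (int N + 1) V)) m (l + m - 1)"
    using fun_cong[OF fun_cong[OF eq, of m], of "l + m"] by (simp only: 1)
  then show ?thesis
    unfolding subst_q_def using cube[of l] cube[of "l + m - 1"] l by simp
qed

text \<open>Comparing coefficients in \<open>q^m V_m = q V_m\<close> shifts the order by m - 1,
  which is nonzero; so each coefficient equals one of lower order, and the descent ends at negative
  orders.\<close>

lemma coeff_concentrated:
  fixes V :: "int \<Rightarrow> int \<Rightarrow> 'a::field"
  assumes neg: "\<And>m n. n < 0 \<Longrightarrow> V m n = 0"
    and rec: "\<And>m l. l \<le> int N \<Longrightarrow> l + m - 1 \<le> int N \<Longrightarrow> V m l = V m (l + m - 1)"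
    and "m \<noteq> 1" "l \<le> int N"
  shows "V m l = 0"
  using \<open>l \<le> int N\<close>
proof (induction "nat (l + 1)" arbitrary: l rule: less_induct)
  case less
  show ?case
  proof (cases "l < 0")
    case False
    \<comment> \<open>The recurrence is read backwards for m \<ge> 2 and forwards for m \<le> 0, so
      that \<open>l'\<close> lies below \<open>l\<close> either way.\<close>
    define l' where "l' = (if m \<ge> 2 then l - (m - 1) else l + m - 1)"
    have l': "l' < l" using \<open>m \<noteq> 1\<close> by (auto simp: l'_def)
    have "V m l = V m l'"
      using rec[of l' m] rec[of l m] l' less.prems by (auto simp: l'_def split: if_splits)
    also have "\<dots> = 0"
      using l' less.prems False by (intro less.hyps) auto
    finally show ?thesis .
  qed (use neg in simp)
qed

section \<open>Arrays with finitely many powers of z at each order, and their power series\<close>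

definition laurent_array :: "(int \<Rightarrow> int \<Rightarrow> 'a::field) \<Rightarrow> bool" where
  "laurent_array v \<longleftrightarrow> (\<forall>m n. n < 0 \<longrightarrow> v m n = 0) \<and> (\<forall>n. finite {m. v m n \<noteq> 0})"

lemma laurent_arrayD: "laurent_array v \<Longrightarrow> n < 0 \<Longrightarrow> v m n = 0"
  by (simp add: laurent_array_def)

text \<open>The evaluation point is any field element: \<open>zvar\<close> gives series over the
  rational functions, and 1 reveals the single surviving coefficient of V.\<close>

definition array_series :: "'a::field \<Rightarrow> (int \<Rightarrow> int \<Rightarrow> 'a) \<Rightarrow> 'a fps" where
  "array_series z v = Abs_fps (\<lambda>n. \<Sum>m | v m (int n) \<noteq> 0. v m (int n) * z powi m)"

lemma array_series_nth:
  assumes "finite A" "{m. v m (int n) \<noteq> 0} \<subseteq> A"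
  shows "array_series z v $ n = (\<Sum>m\<in>A. v m (int n) * z powi m)"
  unfolding array_series_def fps_nth_Abs_fps using assms by (intro sum.mono_neutral_left) auto

lemma laurent_array_combine:
  assumes "laurent_array v" "laurent_array w" "\<And>m n. u m n \<noteq> 0 \<Longrightarrow> v m n \<noteq> 0 \<or> w m n \<noteq> 0"
  shows "laurent_array u"
proof -
  have "{m. u m n \<noteq> 0} \<subseteq> {m. v m n \<noteq> 0} \<union> {m. w m n \<noteq> 0}" for n using assms(3) by auto
  moreover have "finite ({m. v m n \<noteq> 0} \<union> {m. w m n \<noteq> 0})" for n
    using assms(1,2) by (simp add: laurent_array_def)
  ultimately have "finite {m. u m n \<noteq> 0}" for n by (rule finite_subset)
  moreover have "u m n = 0" if "n < 0" for m n
    using laurent_arrayD[OF assms(1) that, of m] laurent_arrayD[OF assms(2) that, of m] assms(3)[of m n] by metis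
  ultimately show ?thesis by (simp add: laurent_array_def)
qed

lemma Collect_shift: "{m::int. P (m - i)} = (\<lambda>m. m + i) ` {m. P m}"
proof (intro equalityI subsetI)
  fix m assume "m \<in> {m. P (m - i)}"
  then show "m \<in> (\<lambda>m. m + i) ` {m. P m}" by (intro image_eqI[of _ _ "m - i"]) auto
qed auto

lemma laurent_array_shift:
  assumes "laurent_array v" "j \<ge> 0"
  shows "laurent_array (\<lambda>m n. v (m - i) (n - j))"
proof -
  have "{m. v (m - i) (n - j) \<noteq> 0} = (\<lambda>m. m + i) ` {m. v m (n - j) \<noteq> 0}" for n
    by (rule Collect_shift)
  then show ?thesis using assms by (simp add: laurent_array_def)
qed

lemma laurent_array_binom_op:
  assumes "laurent_array v" "j \<ge> 0"
  shows "laurent_array (binom_op i j v)"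
  by (rule laurent_array_combine[OF assms(1) laurent_array_shift[OF assms, of i]]) (auto simp: binom_op_def)

lemma laurent_array_theta_op: "laurent_array v \<Longrightarrow> laurent_array (theta_op N v)"
  by (induction N) (simp_all add: laurent_array_binom_op)

lemma laurent_array_scale: "laurent_array v \<Longrightarrow> laurent_array (\<lambda>m n. c m n * v m n)"
  by (rule laurent_array_combine[of v v]) auto

lemma laurent_array_add: "laurent_array v \<Longrightarrow> laurent_array w \<Longrightarrow> laurent_array (\<lambda>m n. v m n + w m n)"
  by (rule laurent_array_combine[of v w]) auto

lemma array_series_add:
  "laurent_array v \<Longrightarrow> laurent_array w \<Longrightarrow>
    array_series z (\<lambda>m n. v m n + w m n) = array_series z v + array_series z w"
proof (rule fps_ext)
  fix n :: nat assume vw: "laurent_array v" "laurent_array w"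
  define A where "A = {m. v m (int n) \<noteq> 0} \<union> {m. w m (int n) \<noteq> 0}"
  have fin: "finite A" using vw by (simp add: A_def laurent_array_def)
  have "array_series z v $ n = (\<Sum>m\<in>A. v m (int n) * z powi m)" "array_series z w $ n = (\<Sum>m\<in>A. w m (int n) * z powi m)"
    using fin by (auto simp: A_def intro!: array_series_nth)
  moreover
  have "array_series z (\<lambda>m n. v m n + w m n) $ n = (\<Sum>m\<in>A. (v m (int n) + w m (int n)) * z powi m)"
    using fin by (intro array_series_nth) (auto simp: A_def)
  ultimately show "array_series z (\<lambda>m n. v m n + w m n) $ n = (array_series z v + array_series z w) $ n"
    by (simp add: distrib_right sum.distrib)
qed

lemma array_series_scale: "laurent_array v \<Longrightarrow> array_series z (\<lambda>m n. c * v m n) = fps_const c * array_series z v"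
proof (rule fps_ext)
  fix n assume v: "laurent_array v"
  then have "array_series z (\<lambda>m n. c * v m n) $ n = (\<Sum>m | v m (int n) \<noteq> 0. c * v m (int n) * z powi m)"
    by (intro array_series_nth) (auto simp: laurent_array_def)
  also have "\<dots> = (fps_const c * array_series z v) $ n"
    by (simp add: array_series_def sum_distrib_left mult.assoc)
  finally show "array_series z (\<lambda>m n. c * v m n) $ n = (fps_const c * array_series z v) $ n" .
qed

lemma array_series_shift:
  assumes "laurent_array v" "z \<noteq> 0"
  shows "array_series z (\<lambda>m n. v (m - i) (n - int j)) = fps_const (z powi i) * fps_X ^ j * array_series z v"
proof (rule fps_ext)
  fix n
  show "array_series z (\<lambda>m n. v (m - i) (n - int j)) $ n = (fps_const (z powi i) * fps_X ^ j * array_series z v) $ n"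
  proof (cases "n < j")
    case True
    then show ?thesis using laurent_arrayD[OF assms(1)] by (simp add: array_series_def fps_X_power_mult_nth mult.assoc)
  next
    case False
    let ?A = "{m. v m (int (n - j)) \<noteq> 0}"
    have fin: "finite ?A" using assms(1) by (simp add: laurent_array_def)
    have "array_series z (\<lambda>m n. v (m - i) (n - int j)) $ n =
        (\<Sum>m\<in>(\<lambda>m. m + i) ` ?A. v (m - i) (int n - int j) * z powi m)"
      using fin False Collect_shift[of "\<lambda>m. v m (int n - int j) \<noteq> 0" i]
      by (intro array_series_nth) (simp_all add: of_nat_diff)
    also have "\<dots> = (\<Sum>m\<in>?A. v m (int (n - j)) * z powi (m + i))"
      using False by (subst sum.reindex) (auto simp: of_nat_diff inj_on_def)
    also have "\<dots> = z powi i * array_series z v $ (n - j)"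
      unfolding array_series_def using assms(2) by (simp add: sum_distrib_left power_int_add mult_ac)
    finally show ?thesis using False by (simp add: fps_X_power_mult_nth mult.assoc)
  qed
qed

lemma array_series_binom_op:
  assumes "laurent_array v" "z \<noteq> 0"
  shows "array_series z (binom_op i (int j) v) = (1 - fps_const (z powi i) * fps_X ^ j) * array_series z v"
proof -
  have "binom_op i (int j) v = (\<lambda>m n. v m n + (-1) * v (m - i) (n - int j))"
    by (simp add: binom_op_def)
  then have "array_series z (binom_op i (int j) v) = array_series z (\<lambda>m n. v m n + (-1) * v (m - i) (n - int j))"
    by (rule arg_cong)
  also have "\<dots> = array_series z v + array_series z (\<lambda>m n. (-1) * v (m - i) (n - int j))"
    using assms by (intro array_series_add laurent_array_scale laurent_array_shift) auto
  also have "\<dots> = array_series z v + fps_const (-1) * (fps_const (z powi i) * fps_X ^ j * array_series z v)"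
    using assms by (subst array_series_scale) (auto simp: array_series_shift intro!: laurent_array_shift)
  finally show ?thesis by (simp add: algebra_simps flip: fps_const_neg)
qed

lemma array_series_theta_op:
  assumes "laurent_array v" "z \<noteq> 0"
  shows "array_series z (theta_op N v) =
    (\<Prod>k=1..N. 1 - fps_const z * fps_X ^ k) * (\<Prod>k=1..N. 1 - fps_const (1 / z) * fps_X ^ k) * array_series z v"
proof (induction N)
  case (Suc N)
  have N: "int N + 1 = int (Suc N)" by simp
  have "array_series z (theta_op (Suc N) v) = (1 - fps_const (z powi 1) * fps_X ^ Suc N) *
      ((1 - fps_const (z powi (-1)) * fps_X ^ Suc N) * array_series z (theta_op N v))"
    unfolding theta_op.simps N
    by (simp only: array_series_binom_op[OF laurent_array_binom_op[OF laurent_array_theta_op[OF assms(1)] of_nat_0_le_iff] assms(2)]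
        array_series_binom_op[OF laurent_array_theta_op[OF assms(1)] assms(2)])
  then show ?case
    unfolding Suc by (simp add: ac_simps power_int_minus inverse_eq_divide)
qed simp

subsection \<open>Dyson's bijection\<close>

text \<open>Removes the first column of the Young diagram; \<open>inc_parts l\<close> puts a column
  of length l in front, which makes sense if there are at most l parts.\<close>

definition dec_parts :: "nat multiset \<Rightarrow> nat multiset" where
  "dec_parts p = {#k \<in># image_mset (\<lambda>k. k - 1) p. k > 0#}"

definition inc_parts :: "nat \<Rightarrow> nat multiset \<Rightarrow> nat multiset" where
  "inc_parts l q = image_mset Suc q + replicate_mset (l - size q) 1"

lemma size_dec_parts: "size (dec_parts p) \<le> size p"
  unfolding dec_parts_def by (metis size_filter_mset_lesseq size_image_mset)

lemma sum_dec_parts: "0 \<notin># p \<Longrightarrow> sum_mset (dec_parts p) + size p = sum_mset p"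
  by (induction p) (auto simp: dec_parts_def)

lemma inc_dec_parts: "0 \<notin># p \<Longrightarrow> inc_parts (size p) (dec_parts p) = p"
proof (induction p)
  case (add x p)
  have x: "x > 0" using add.prems by auto
  have IH: "inc_parts (size p) (dec_parts p) = p" using add by auto
  show ?case
  proof (cases "x = 1")
    case True
    then have "dec_parts (add_mset x p) = dec_parts p" by (simp add: dec_parts_def)
    then show ?thesis using IH True size_dec_parts[of p] by (simp add: inc_parts_def Suc_diff_le)
  next
    case False
    then have "dec_parts (add_mset x p) = add_mset (x - 1) (dec_parts p)"
      using x by (simp add: dec_parts_def)
    then show ?thesis using IH x by (simp add: inc_parts_def)
  qed
qed (simp add: inc_parts_def dec_parts_def)

lemma dec_inc_parts:
  assumes "0 \<notin># q"
  shows "dec_parts (inc_parts l q) = q"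
proof -
  have "dec_parts (inc_parts l q) = dec_parts (image_mset Suc q) + dec_parts (replicate_mset (l - size q) 1)"
    by (simp add: dec_parts_def inc_parts_def)
  also have "dec_parts (replicate_mset (l - size q) 1) = {#}"
    by (simp add: dec_parts_def)
  also have "dec_parts (image_mset Suc q) = q"
    using assms by (induction q) (auto simp: dec_parts_def)
  finally show ?thesis by simp
qed

lemma sum_inc_parts: "size q \<le> l \<Longrightarrow> sum_mset (inc_parts l q) = sum_mset q + l"
proof -
  have "sum_mset (image_mset Suc q) = sum_mset q + size q" by (induction q) auto
  then show "size q \<le> l \<Longrightarrow> ?thesis" by (simp add: inc_parts_def sum_mset_replicate_mset)
qed

lemma size_inc_parts: "size q \<le> l \<Longrightarrow> size (inc_parts l q) = l"
  by (simp add: inc_parts_def)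

lemma Max_eq_part:
  assumes "p \<in> partitions_of n" "n > 0"
  shows "Max (set_mset p) \<in># p" "\<And>i. i \<in># p \<Longrightarrow> i \<le> Max (set_mset p)" "Max (set_mset p) \<ge> 1" "size p \<ge> 1"
proof -
  have ne: "p \<noteq> {#}" using partitions_of_nonempty[OF assms] .
  then show M: "Max (set_mset p) \<in># p" by (intro Max_in) auto
  show "\<And>i. i \<in># p \<Longrightarrow> i \<le> Max (set_mset p)" by simp
  show "Max (set_mset p) \<ge> 1"
    using M assms(1) by (metis (mono_tags, lifting) partitions_of_def mem_Collect_eq not_less_eq_eq le_0_eq One_nat_def)
  show "size p \<ge> 1" using ne by (simp add: Suc_le_eq nonempty_has_size)
qed

text \<open>The bound on the rank of \<open>p\<close> says that the shortened parts fit under the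
  new row b, and the new rank is at least r - 1 because shortening creates no parts.\<close>

lemma dyson_map_mem:
  assumes "n \<ge> 1" "int n + r \<ge> 1" "p \<in> partitions_of n" "partition_rank p \<le> r + 1"
    and "b = nat (int (size p) + r)"
  shows "int b = int (size p) + r" "Max (set_mset (add_mset b (dec_parts p))) = b"
    and "add_mset b (dec_parts p) \<in> partitions_of (nat (int n + r))"
    and "partition_rank (add_mset b (dec_parts p)) \<ge> r - 1"
proof -
  have n: "n > 0" using assms(1) by simp
  note M = Max_eq_part[OF assms(3) n]
  have rk: "int (Max (set_mset p)) \<le> int (size p) + r + 1"
    using assms(4) by (simp add: partition_rank_def)
  then show b: "int b = int (size p) + r" using M(3) assms(5) by simp
  have p: "0 \<notin># p" "sum_mset p = n" using assms(3) by (auto simp: partitions_of_def)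
  have le: "i \<le> b" if i: "i \<in># dec_parts p" for i
  proof -
    obtain k where "k \<in># p" "i = k - 1" using i by (auto simp: dec_parts_def)
    then show ?thesis using M(2)[of k] rk b by linarith
  qed
  then show Mb: "Max (set_mset (add_mset b (dec_parts p))) = b"
    by (intro Max_eqI) auto
  have sum: "int (sum_mset (dec_parts p)) + int (size p) = int n"
    using sum_dec_parts[OF p(1)] p(2) by linarith
  \<comment> \<open>An empty row would leave no parts at all and force n + r = 0.\<close>
  have "b \<noteq> 0"
  proof
    assume "b = 0"
    moreover have "i > 0" if "i \<in># dec_parts p" for i using that by (simp add: dec_parts_def)
    ultimately have "i \<notin># dec_parts p" for i using le[of i] by auto
    then have "dec_parts p = {#}" by blast
    then show False using sum b assms(2) \<open>b = 0\<close> by simp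
  qed
  have sum0: "b + sum_mset (dec_parts p) = nat (int n + r)" using sum b by linarith
  show "add_mset b (dec_parts p) \<in> partitions_of (nat (int n + r))"
    using sum0 \<open>b \<noteq> 0\<close> by (simp add: partitions_of_def dec_parts_def)
  show "partition_rank (add_mset b (dec_parts p)) \<ge> r - 1"
    unfolding partition_rank_def Mb using size_dec_parts[of p] b by simp
qed

text \<open>Here the rank bound says that a column of length b - r is long enough for all parts of
  \<open>q\<close>.\<close>

lemma dyson_inverse_mem:
  assumes "n \<ge> 1" "int n + r \<ge> 1" "add_mset b q \<in> partitions_of (nat (int n + r))"
    and "Max (set_mset (add_mset b q)) = b" "partition_rank (add_mset b q) \<ge> r - 1"
    and "l = nat (int b - r)"
  shows "int l = int b - r" "size q \<le> l" "0 \<notin># q"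
    and "inc_parts l q \<in> partitions_of n" "partition_rank (inc_parts l q) \<le> r + 1"
proof -
  have rk: "int (size q) \<le> int b - r"
    using assms(5) unfolding partition_rank_def assms(4) by simp
  then show l: "int l = int b - r" and sl: "size q \<le> l" using assms(6) by auto
  have "b + sum_mset q = nat (int n + r)" and q1: "0 \<notin># q"
    using assms(3) by (auto simp: partitions_of_def)
  then have q: "0 \<notin># q" "int b + int (sum_mset q) = int n + r"
    using assms(2) by linarith+
  then show "0 \<notin># q" by simp
  have "sum_mset (inc_parts l q) = n" using sum_inc_parts[OF sl] q(2) l by linarith
  then show mem: "inc_parts l q \<in> partitions_of n"
    by (auto simp: partitions_of_def inc_parts_def)
  have le: "i \<le> b" if "i \<in># q" for i
  proof -
    have "i \<le> Max (set_mset (add_mset b q))" using that by simp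
    then show ?thesis unfolding assms(4) .
  qed
  have "Max (set_mset (inc_parts l q)) \<in># inc_parts l q"
    using Max_eq_part(1)[OF mem] assms(1) by simp
  then have "Max (set_mset (inc_parts l q)) \<le> b + 1"
    using le by (auto simp: inc_parts_def)
  then show "partition_rank (inc_parts l q) \<le> r + 1"
    unfolding partition_rank_def size_inc_parts[OF sl] using l by linarith
qed

lemma dyson_bijection:
  assumes "n \<ge> 1" "int n + r \<ge> 1"
  shows "card {p \<in> partitions_of n. partition_rank p \<le> r + 1} =
    card {p \<in> partitions_of (nat (int n + r)). partition_rank p \<ge> r - 1}"
proof -
  let ?A = "{p \<in> partitions_of n. partition_rank p \<le> r + 1}"
  let ?B = "{p \<in> partitions_of (nat (int n + r)). partition_rank p \<ge> r - 1}"
  let ?f = "\<lambda>p. add_mset (nat (int (size p) + r)) (dec_parts p)"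
  let ?g = "\<lambda>p. inc_parts (nat (int (Max (set_mset p)) - r)) (p - {#Max (set_mset p)#})"
  have split: "\<exists>b q. p = add_mset b q \<and> Max (set_mset p) = b" if "p \<in> ?B" for p
  proof -
    have "Max (set_mset p) \<in># p"
      using that assms(2) Max_eq_part(1)[of p "nat (int n + r)"] by simp
    then show ?thesis by (metis mset_add)
  qed
  have "bij_betw ?f ?A ?B"
  proof (rule bij_betw_byWitness[where f' = ?g])
    show "\<forall>p\<in>?A. ?g (?f p) = p"
    proof
      fix p assume p: "p \<in> ?A"
      then have "0 \<notin># p" by (auto simp: partitions_of_def)
      note inc_dec_parts[OF this]
      moreover have "partition_rank p \<le> r + 1" "p \<in> partitions_of n" using p by auto
      note dyson_map_mem(1,2)[OF assms this(2,1) refl]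
      ultimately show "?g (?f p) = p" by (simp only: add_diff_cancel_right' nat_int inc_dec_parts add_mset_remove_trivial not_False_eq_True)
    qed
    show "\<forall>p\<in>?B. ?f (?g p) = p"
    proof
      fix p assume p: "p \<in> ?B"
      from split[OF this] obtain b q where bq: "p = add_mset b q" "Max (set_mset p) = b" by blast
      have g: "?g p = inc_parts (nat (int b - r)) q" unfolding bq(2) unfolding bq(1) by simp
      have mem: "add_mset b q \<in> partitions_of (nat (int n + r))" "Max (set_mset (add_mset b q)) = b"
        "partition_rank (add_mset b q) \<ge> r - 1"
        using p bq(2) unfolding bq(1) by simp_all
      note inv = dyson_inverse_mem[OF assms mem refl]
      have "?f (?g p) = add_mset b q"
        unfolding g size_inc_parts[OF inv(2)] dec_inc_parts[OF inv(3)] inv(1) by simp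
      then show "?f (?g p) = p" by (simp only: bq(1))
    qed
    show "?f ` ?A \<subseteq> ?B"
      using dyson_map_mem(3,4)[OF assms _ _ refl] by blast
    show "?g ` ?B \<subseteq> ?A"
    proof
      fix p' assume "p' \<in> ?g ` ?B"
      then obtain p where p: "p \<in> ?B" "p' = ?g p" by blast
      from split[OF p(1)] obtain b q where bq: "p = add_mset b q" "Max (set_mset p) = b" by blast
      have g: "?g p = inc_parts (nat (int b - r)) q" unfolding bq(2) unfolding bq(1) by simp
      have mem: "add_mset b q \<in> partitions_of (nat (int n + r))" "Max (set_mset (add_mset b q)) = b"
        "partition_rank (add_mset b q) \<ge> r - 1"
        using p(1) bq(2) unfolding bq(1) by simp_all
      show "p' \<in> ?A"
        unfolding p(2) g using dyson_inverse_mem(4,5)[OF assms mem refl] by simp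
    qed
  qed
  then show ?thesis by (rule bij_betw_same_card)
qed

text \<open>The largest part is at most n and there is at least one part. Together with
  \<open>rank_minimal\<close> this settles the orders at which one side of the functional equation
  concerns partitions of a number \<le> 0, where the bijection does not apply.\<close>

lemma rank_maximal:
  assumes "n \<ge> 1" "int n - 1 \<le> r"
  shows "{p \<in> partitions_of n. partition_rank p \<ge> r} = (if r = int n - 1 then {{#n#}} else {})"
proof -
  have eq: "r = int n - 1 \<and> p = {#n#}" if p: "p \<in> partitions_of n" "partition_rank p \<ge> r" for p
  proof -
    have "int (Max (set_mset p)) - int (size p) \<ge> r" using p(2) by (simp add: partition_rank_def)
    moreover have "Max (set_mset p) \<le> n" "size p \<ge> 1"
      using Max_partitions_of_le[OF p(1)] Max_eq_part(4)[OF p(1)] assms(1) by auto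
    ultimately have "size p = 1" and r: "r = int n - 1" using assms(2) by linarith+
    then obtain k where "p = {#k#}" using size_1_singleton_mset by metis
    then show ?thesis using p r by (auto simp: partitions_of_def)
  qed
  have mem: "{#n#} \<in> partitions_of n" "partition_rank {#n#} = int n - 1"
    using assms(1) by (auto simp: partitions_of_def partition_rank_def)
  show ?thesis
  proof (cases "r = int n - 1")
    case True
    have "{p \<in> partitions_of n. partition_rank p \<ge> r} \<subseteq> {{#n#}}" using eq by blast
    moreover have "{#n#} \<in> {p \<in> partitions_of n. partition_rank p \<ge> r}" using mem True by simp
    ultimately have "{p \<in> partitions_of n. partition_rank p \<ge> r} = {{#n#}}" by blast
    then show ?thesis using True by simp
  next
    case False
    then show ?thesis using eq by (simp only: if_False) blast
  qed
qed

lemma rank_minimal: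
  assumes "n \<ge> 1" "r \<le> 1 - int n"
  shows "{p \<in> partitions_of n. partition_rank p \<le> r} = (if r = 1 - int n then {replicate_mset n 1} else {})"
proof -
  have eq: "r = 1 - int n \<and> p = replicate_mset n 1" if p: "p \<in> partitions_of n" "partition_rank p \<le> r" for p
  proof -
    have n: "n > 0" using assms(1) by simp
    have "int (Max (set_mset p)) - int (size p) \<le> r" using p(2) by (simp add: partition_rank_def)
    moreover have "size p \<le> n" by (rule partitions_of_bounds(1)[OF p(1)])
    ultimately have sz: "size p = n" and M: "Max (set_mset p) = 1" and r: "r = 1 - int n"
      using assms(2) Max_eq_part(3)[OF p(1) n] by linarith+
    have "set_mset p \<subseteq> {1}"
    proof
      fix i assume i: "i \<in> set_mset p"
      then have "i \<le> 1" using Max_eq_part(2)[OF p(1) n] M by metis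
      moreover have "i \<noteq> 0" using p(1) i by (metis (mono_tags, lifting) partitions_of_def mem_Collect_eq)
      ultimately show "i \<in> {1}" by simp
    qed
    then show ?thesis using sz r by (metis set_mset_subset_singletonD)
  qed
  have mem: "replicate_mset n 1 \<in> partitions_of n" "partition_rank (replicate_mset n 1) = 1 - int n"
    using assms(1) by (auto simp: partitions_of_def partition_rank_def sum_mset_replicate_mset)
  show ?thesis
  proof (cases "r = 1 - int n")
    case True
    have "{p \<in> partitions_of n. partition_rank p \<le> r} \<subseteq> {replicate_mset n 1}" using eq by blast
    moreover have "replicate_mset n 1 \<in> {p \<in> partitions_of n. partition_rank p \<le> r}" using mem True by simp
    ultimately have "{p \<in> partitions_of n. partition_rank p \<le> r} = {replicate_mset n 1}" by blast
    then show ?thesis using True by simp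
  next
    case False
    then show ?thesis using eq by (simp only: if_False) blast
  qed
qed

text \<open>The empty partition, on which \<open>partition_rank\<close> is junk, gets rank 0.\<close>

definition full_rank :: "nat multiset \<Rightarrow> int" where
  "full_rank p = (if p = {#} then 0 else partition_rank p)"

lemma full_rank_partition_rank:
  assumes "n \<ge> 1"
  shows "{p \<in> partitions_of n. Q (full_rank p)} = {p \<in> partitions_of n. Q (partition_rank p)}"
  using partitions_of_nonempty[of _ n] assms by (auto simp: full_rank_def)

lemma full_rank_0: "{p \<in> partitions_of 0. Q (full_rank p)} = (if Q 0 then {{#}} else {})"
  by (auto simp: partitions_of_0 full_rank_def)

lemma N_rank_full_rank: "N_rank m n = card {p \<in> partitions_of n. full_rank p = m}"
  using full_rank_partition_rank[of n "\<lambda>k. k = m"] full_rank_0[of "\<lambda>k. k = m"]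
  by (cases "n = 0") (simp_all add: N_rank_def)

text \<open>Coefficients of R / (1 - z): \<open>rank_le\<close> for the expansion in ascending
  powers of z, minus \<open>rank_gt\<close> for the one in descending powers. Integer orders leave
  room for the shift to n - m.\<close>

definition rank_le :: "int \<Rightarrow> int \<Rightarrow> nat" where
  "rank_le m n = (if n < 0 then 0 else card {p \<in> partitions_of (nat n). full_rank p \<le> m})"

definition rank_gt :: "int \<Rightarrow> int \<Rightarrow> nat" where
  "rank_gt m n = (if n < 0 then 0 else card {p \<in> partitions_of (nat n). full_rank p > m})"

definition rank_eq :: "int \<Rightarrow> int \<Rightarrow> nat" where
  "rank_eq m n = (if n < 0 then 0 else card {p \<in> partitions_of (nat n). full_rank p = m})"

lemma card_partitions_split:
  assumes "\<And>p. Q p \<longleftrightarrow> Q1 p \<or> Q2 p" "\<And>p. \<not> (Q1 p \<and> Q2 p)"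
  shows "card {p \<in> partitions_of n. Q p} = card {p \<in> partitions_of n. Q1 p} + card {p \<in> partitions_of n. Q2 p}"
proof -
  have "{p \<in> partitions_of n. Q p} = {p \<in> partitions_of n. Q1 p} \<union> {p \<in> partitions_of n. Q2 p}"
    using assms(1) by blast
  moreover have "{p \<in> partitions_of n. Q1 p} \<inter> {p \<in> partitions_of n. Q2 p} = {}"
    using assms(2) by blast
  ultimately show ?thesis
    by (simp add: card_Un_disjoint finite_partitions_of)
qed

lemma rank_le_rec: "rank_le m n = rank_le (m - 1) n + rank_eq m n"
proof -
  have "card {p \<in> partitions_of (nat n). full_rank p \<le> m} =
      card {p \<in> partitions_of (nat n). full_rank p \<le> m - 1} + card {p \<in> partitions_of (nat n). full_rank p = m}"
    by (rule card_partitions_split) linarith+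
  then show ?thesis by (simp add: rank_le_def rank_eq_def)
qed

lemma rank_gt_rec: "rank_gt (m - 1) n = rank_gt m n + rank_eq m n"
proof -
  have "card {p \<in> partitions_of (nat n). full_rank p > m - 1} =
      card {p \<in> partitions_of (nat n). full_rank p > m} + card {p \<in> partitions_of (nat n). full_rank p = m}"
    by (rule card_partitions_split) linarith+
  then show ?thesis by (simp add: rank_gt_def rank_eq_def)
qed

text \<open>The coefficient of \<open>z^m q^n\<close> in
  \<open>S(zq) + q z^3 S(z) = 1 - q z^2\<close>, with S(zq) in ascending and S(z) in descending
  powers.\<close>

lemma rank_functional_eq:
  "int (rank_le m (n - m)) - int (rank_gt (m - 3) (n - 1)) =
    (if m = 0 \<and> n = 0 then 1 else 0) - (if m = 2 \<and> n = 1 then 1 else 0)"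
proof -
  define k where "k = n - m"
  have gt: "full_rank p > m - 3 \<longleftrightarrow> full_rank p \<ge> m - 2" for p by auto
  have le_neg: "rank_le m k = 0" if "k < 0" using that by (simp add: rank_le_def)
  have gt_neg: "rank_gt (m - 3) (n - 1) = 0" if "n < 1" using that by (simp add: rank_gt_def)
  have le_0: "rank_le m 0 = (if m \<ge> 0 then 1 else 0)"
    using full_rank_0[of "\<lambda>i. i \<le> m"] by (simp add: rank_le_def)
  have gt_0: "rank_gt (m - 3) 0 = (if m \<le> 2 then 1 else 0)"
    using full_rank_0[of "\<lambda>i. i > m - 3"] by (simp add: rank_gt_def)
  have le_pos: "rank_le m k = card {p \<in> partitions_of (nat k). partition_rank p \<le> m}" if "k \<ge> 1"
    using that full_rank_partition_rank[of "nat k" "\<lambda>i. i \<le> m"] by (simp add: rank_le_def)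
  have gt_pos: "rank_gt (m - 3) (n - 1) = card {p \<in> partitions_of (nat (n - 1)). partition_rank p \<ge> m - 2}" if "n \<ge> 2"
    using that full_rank_partition_rank[of "nat (n - 1)" "\<lambda>i. i \<ge> m - 2"] by (simp add: rank_gt_def gt)
  have le_min: "rank_le m k = (if m = 1 - k then 1 else 0)" if "k \<ge> 1" "m \<le> 1 - k"
    using that le_pos rank_minimal[of "nat k" m] by simp
  have gt_max: "rank_gt (m - 3) (n - 1) = (if m = n then 1 else 0)" if "n \<ge> 2" "m \<ge> n"
    using that gt_pos rank_maximal[of "nat (n - 1)" "m - 2"] by simp
  consider "k < 0" "n < 1" | "k < 0" "n = 1" | "k < 0" "n \<ge> 2" | "k = 0" "n < 1" | "k = 0" "n = 1"
    | "k = 0" "n \<ge> 2" | "k \<ge> 1" "n < 1" | "k \<ge> 1" "n = 1" | "k \<ge> 1" "n \<ge> 2" by linarith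
  then have "int (rank_le m k) - int (rank_gt (m - 3) (n - 1)) =
    (if m = 0 \<and> n = 0 then 1 else 0) - (if m = 2 \<and> n = 1 then 1 else 0)"
  proof cases
    \<comment> \<open>Dyson's bijection with r = m - 1, as k + (m - 1) = n - 1. All other cases are
      boundary orders.\<close>
    case 9
    have e: "int (nat k) + (m - 1) = n - 1" using 9 by (simp add: k_def)
    have "card {p \<in> partitions_of (nat k). partition_rank p \<le> m} =
        card {p \<in> partitions_of (nat (n - 1)). partition_rank p \<ge> m - 2}"
      using dyson_bijection[of "nat k" "m - 1", unfolded e] 9 by simp
    then have "rank_le m k = rank_gt (m - 3) (n - 1)" using le_pos gt_pos 9 by simp
    then show ?thesis using 9 by (auto simp: k_def)
  qed (use le_neg gt_neg le_0 gt_0 le_min gt_max in \<open>auto simp: k_def\<close>)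
  then show ?thesis by (simp add: k_def)
qed

subsection \<open>The partial differential equation\<close>

text \<open>
  \<open>pde_weight m n\<close> is the eigenvalue of \<open>6 \<delta>\<^sub>q + \<delta>\<^sub>z + \<delta>\<^sub>z\<^sup>2\<close> on \<open>z\<^sup>m q\<^sup>n\<close>. The arrays \<open>weighted_le\<close> and
  \<open>weighted_gt\<close> are the images under this operator of \<open>R / (1 - z)\<close>, expanded in powers of \<open>z\<close> and
  of \<open>1 / z\<close> respectively; they have the same product with \<open>(1 - z)\<^sup>3\<close>.
\<close>

definition pde_weight :: "int \<Rightarrow> int \<Rightarrow> int" where
  "pde_weight m n = 6 * n + m * m + m"

definition weighted_le :: "int \<Rightarrow> int \<Rightarrow> 'a::field" where
  "weighted_le m n = of_int (pde_weight m n) * of_nat (rank_le m n)"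

definition weighted_gt :: "int \<Rightarrow> int \<Rightarrow> 'a::field" where
  "weighted_gt m n = of_int (pde_weight m n) * - of_nat (rank_gt m n)"

definition rank_array :: "int \<Rightarrow> int \<Rightarrow> 'a::field" where
  "rank_array m n = of_nat (rank_eq m n)"

lemma weighted_functional_eq:
  "subst_q weighted_le = (\<lambda>m n. - (weighted_gt (m - 3) (n - 1) :: 'a::field))"
proof (intro ext)
  fix m n
  \<comment> \<open>Among the weights \<open>a n + m^2 + b m\<close> only a = 6, b = 1 has this
    invariance.\<close>
  have "pde_weight m (n - m) = pde_weight (m - 3) (n - 1)"
    by (simp add: pde_weight_def algebra_simps)
  \<comment> \<open>The inhomogeneous terms meet the weight at the arguments (0, 0) and (2, -1),
    both of which are zeros of it.\<close>
  moreover have "pde_weight m (n - m) * (int (rank_le m (n - m)) - int (rank_gt (m - 3) (n - 1))) = 0"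
    unfolding rank_functional_eq by (auto simp: pde_weight_def)
  ultimately have "pde_weight m (n - m) * int (rank_le m (n - m)) =
      pde_weight (m - 3) (n - 1) * int (rank_gt (m - 3) (n - 1))"
    by (simp add: algebra_simps)
  then have "(of_int (pde_weight m (n - m) * int (rank_le m (n - m))) :: 'a) =
      of_int (pde_weight (m - 3) (n - 1) * int (rank_gt (m - 3) (n - 1)))"
    by (rule arg_cong)
  then show "subst_q weighted_le m n = - (weighted_gt (m - 3) (n - 1) :: 'a)"
    by (simp add: subst_q_def weighted_le_def weighted_gt_def)
qed

text \<open>Twice the operator on R in the second identity; it is what \<open>(1 - z)^3 D\<close>
  becomes when R / (1 - z) is expressed through R.\<close>

definition pde_array :: "(int \<Rightarrow> int \<Rightarrow> 'a::field) \<Rightarrow> int \<Rightarrow> int \<Rightarrow> 'a" where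
  "pde_array r = (\<lambda>m n. binom_op 1 0 (binom_op 1 0 (\<lambda>m n. of_int (6 * n) * r m n)) m n
     + (binom_op 1 0 (binom_op 1 0 (\<lambda>m n. of_int (m * m) * r m n)) m n
     + (binom_op 2 0 (\<lambda>m n. of_int m * r m n) m n + 2 * r (m - 1) (n - 0))))"

text \<open>Only the relation \<open>r = (1 - z) s\<close> enters, so both expansions of R / (1 - z)
  give the same array.\<close>

lemma pde_array_cumulative:
  fixes r s :: "int \<Rightarrow> int \<Rightarrow> 'a::field"
  assumes "\<And>m n. r m n = s m n - s (m - 1) n"
  shows "binom_op 1 0 (binom_op 1 0 (binom_op 1 0 (\<lambda>m n. of_int (pde_weight m n) * s m n))) = pde_array r"
  unfolding pde_array_def binom_op_def assms pde_weight_def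
  by (intro ext) (simp add: algebra_simps)

lemma binom_op_weighted_le:
  "binom_op 1 0 (binom_op 1 0 (binom_op 1 0 weighted_le)) =
    pde_array (rank_array :: int \<Rightarrow> int \<Rightarrow> 'a::field)"
proof -
  have "rank_array m n = (of_nat (rank_le m n) - of_nat (rank_le (m - 1) n) :: 'a)" for m n
    unfolding rank_array_def using rank_le_rec[of m n] by simp
  note pde_array_cumulative[of rank_array "\<lambda>m n. of_nat (rank_le m n)", OF this]
  then show ?thesis by (simp only: weighted_le_def[abs_def])
qed

lemma binom_op_weighted_gt:
  "binom_op 1 0 (binom_op 1 0 (binom_op 1 0 weighted_gt)) =
    pde_array (rank_array :: int \<Rightarrow> int \<Rightarrow> 'a::field)"
proof -
  have "rank_array m n = (- of_nat (rank_gt m n) - - of_nat (rank_gt (m - 1) n) :: 'a)" for m n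
    unfolding rank_array_def using rank_gt_rec[of m n] by simp
  note pde_array_cumulative[of rank_array "\<lambda>m n. - of_nat (rank_gt m n)", OF this]
  then show ?thesis by (simp only: weighted_gt_def[abs_def])
qed

lemma full_theta_cube:
  "full_theta N (full_theta N (full_theta N v)) =
   theta_op N (theta_op N (theta_op N (binom_op 1 0 (binom_op 1 0 (binom_op 1 0 v)))))"
  by (simp only: full_theta_def theta_op_binom_op)

lemma rank_eq_N_rank: "rank_eq m (int n) = N_rank m n"
  by (simp add: rank_eq_def N_rank_full_rank)

lemma rank_eq_support: "{m. (rank_array m (int n) :: 'a::field) \<noteq> 0} \<subseteq> {- int n..int n}"
proof
  fix m assume "m \<in> {m. (rank_array m (int n) :: 'a) \<noteq> 0}"
  then have "N_rank m n \<noteq> 0" by (metis (mono_tags, lifting) mem_Collect_eq of_nat_0 rank_array_def rank_eq_N_rank)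
  then show "m \<in> {- int n..int n}" using N_rank_eq_0 by metis
qed

lemma laurent_array_rank_array: "laurent_array (rank_array :: int \<Rightarrow> int \<Rightarrow> 'a::field)"
proof -
  have neg: "(rank_array m n :: 'a) = 0" if "n < 0" for m n
    using that by (simp add: rank_array_def rank_eq_def)
  have "finite {m. (rank_array m n :: 'a) \<noteq> 0}" for n
  proof (cases "n < 0")
    case False
    then show ?thesis using finite_subset[OF rank_eq_support[of "nat n"]] by simp
  qed (simp add: neg)
  then show ?thesis unfolding laurent_array_def using neg by blast
qed

lemma laurent_array_pde_array: "laurent_array r \<Longrightarrow> laurent_array (pde_array r)"
  unfolding pde_array_def
  by (intro laurent_array_add laurent_array_binom_op laurent_array_scale laurent_array_shift) auto

definition pde_series :: "'a::field \<Rightarrow> (int \<Rightarrow> int \<Rightarrow> 'a) \<Rightarrow> 'a fps" where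
  "pde_series z r =
     (1 - fps_const z) ^ 2 * array_series z (\<lambda>m n. of_int (6 * n) * r m n)
     + ((1 - fps_const z) ^ 2 * array_series z (\<lambda>m n. of_int (m * m) * r m n)
     + ((1 - fps_const (z ^ 2)) * array_series z (\<lambda>m n. of_int m * r m n) + fps_const 2 * (fps_const z * array_series z r)))"

lemma array_series_pde_array:
  assumes "laurent_array r" "z \<noteq> 0"
  shows "array_series z (pde_array r) = pde_series z r"
proof -
  have e1: "array_series z (binom_op 1 0 (binom_op 1 0 v)) = (1 - fps_const z) ^ 2 * array_series z v" if "laurent_array v" for v
    using array_series_binom_op[of "binom_op 1 0 v" z 1 0] array_series_binom_op[of v z 1 0] laurent_array_binom_op[of v 0 1] that assms(2)
    by (simp add: power2_eq_square mult.assoc)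
  have e2: "array_series z (binom_op 2 0 v) = (1 - fps_const (z ^ 2)) * array_series z v" if "laurent_array v" for v
    using array_series_binom_op[of v z 2 0] that assms(2) by simp
  have e3: "array_series z (\<lambda>m n. r (m - 1) (n - 0)) = fps_const z * array_series z r"
    using array_series_shift[of r z 1 0] assms by simp
  note n = laurent_array_add laurent_array_binom_op laurent_array_scale laurent_array_shift
  show ?thesis
    unfolding pde_array_def pde_series_def
    by (subst array_series_add, (intro n assms(1); simp)+)+
      (simp only: e1 e2 e3 laurent_array_scale[OF assms(1)] array_series_scale[OF laurent_array_shift[OF assms(1) order_refl]])
qed

lemma array_series_concentrated:
  assumes "laurent_array V" "\<And>m l. m \<noteq> 1 \<Longrightarrow> l \<le> int N \<Longrightarrow> V m l = 0"
  shows "eq_upto N (array_series z V) (fps_const z * array_series 1 V)"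
  unfolding eq_upto_def
proof (intro allI impI)
  fix n assume n: "n \<le> N"
  have "{m. V m (int n) \<noteq> 0} \<subseteq> {1}" using assms(2)[of _ "int n"] n by force
  then have e: "array_series y V $ n = V 1 (int n) * y powi 1" for y
    by (subst array_series_nth[of "{1}"]) auto
  show "array_series z V $ n = (fps_const z * array_series 1 V) $ n" by (simp add: e mult.commute)
qed

abbreviation qprod :: "nat \<Rightarrow> 'a::field \<Rightarrow> 'a fps" where
  "qprod N z \<equiv> (\<Prod>k=1..N. 1 - fps_const z * fps_X ^ k)"

lemma theta_pde_series:
  fixes z :: "'a::field"
  assumes "z \<noteq> 0"
  shows "eq_upto N ((qprod N z * qprod N (1 / z)) ^ 3 * pde_series z rank_array)
    (fps_const z * (qprod N 1 ^ 6 * pde_series 1 rank_array))"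
proof -
  define V :: "int \<Rightarrow> int \<Rightarrow> 'a" where "V = theta_op N (theta_op N (theta_op N (pde_array rank_array)))"
  have n: "laurent_array (pde_array (rank_array :: int \<Rightarrow> int \<Rightarrow> 'a))"
    by (rule laurent_array_pde_array[OF laurent_array_rank_array])
  have nV: "laurent_array V" unfolding V_def by (intro laurent_array_theta_op n)
  have "V = full_theta N (full_theta N (full_theta N weighted_le))"
    "V = full_theta N (full_theta N (full_theta N weighted_gt))"
    by (simp_all only: full_theta_cube binom_op_weighted_le binom_op_weighted_gt V_def)
  note fe = full_theta_cube_functional_eq[OF weighted_functional_eq this]
  have "V m l = 0" if "m \<noteq> 1" "l \<le> int N" for m l
    using laurent_arrayD[OF nV] coeff_recurrence[OF laurent_arrayD[OF nV] fe] that by (rule coeff_concentrated)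
  then have "eq_upto N (array_series z V) (fps_const z * array_series 1 V)"
    by (rule array_series_concentrated[OF nV])
  moreover have "array_series y V = (qprod N y * qprod N (1 / y)) ^ 3 * pde_series y rank_array" if "y \<noteq> 0" for y
    unfolding V_def
    by (simp only: array_series_theta_op[OF laurent_array_theta_op[OF laurent_array_theta_op[OF n]] that]
        array_series_theta_op[OF laurent_array_theta_op[OF n] that]
        array_series_theta_op[OF n that] array_series_pde_array[OF laurent_array_rank_array that] power3_eq_cube ac_simps)
  ultimately show ?thesis using assms
    by (simp add: mult.assoc flip: power2_eq_square power_mult)
qed

section \<open>The value at z = 1 and the product \<open>(q)_\<infinity>\<close>\<close>

lemma array_series_1_rank_array: "array_series 1 rank_array = (weighted_gf (\<lambda>_. 1) :: 'a::field fps)"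
proof (rule fps_ext)
  fix n
  have "array_series 1 rank_array $ n = (\<Sum>m = - int n..int n. of_nat (N_rank m n) :: 'a)"
    using rank_eq_support by (subst array_series_nth[of "{- int n..int n}"]) (auto simp: rank_array_def rank_eq_N_rank)
  also have "\<dots> = (\<Sum>m = - int n..int n. \<Sum>p\<in>{p \<in> partitions_of n. full_rank p = m}. 1)"
    by (simp add: N_rank_full_rank)
  also have "\<dots> = (\<Sum>p\<in>partitions_of n. 1)"
  proof (intro sum.group)
    show "full_rank ` partitions_of n \<subseteq> {- int n..int n}"
    proof
      fix m assume "m \<in> full_rank ` partitions_of n"
      then have "{p \<in> partitions_of n. full_rank p = m} \<noteq> {}" by auto
      then have "card {p \<in> partitions_of n. full_rank p = m} \<noteq> 0" by (simp add: finite_partitions_of)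
      then have "N_rank m n \<noteq> 0" by (simp add: N_rank_full_rank)
      then show "m \<in> {- int n..int n}" using N_rank_eq_0 by metis
    qed
  qed (auto simp: finite_partitions_of)
  also have "\<dots> = weighted_gf (\<lambda>_. 1) $ n" by (simp add: weighted_gf_nth)
  finally show "array_series 1 rank_array $ n = weighted_gf (\<lambda>_. 1 :: 'a) $ n" .
qed

text \<open>The terms with a factor 1 - z drop out; 2 z R remains, and R at z = 1 counts all
  partitions.\<close>

lemma pde_series_1: "pde_series 1 rank_array = fps_const 2 * (weighted_gf (\<lambda>_. 1) :: 'a::field fps)"
  by (simp add: pde_series_def array_series_1_rank_array)

text \<open>\<open>prodinf\<close> is a definite description, so uniqueness is shown along with
  convergence. The constant coefficient 1 rules out zero factors, which leaves
  \<open>raw_has_prod\<close> from index 0 as the only reading of \<open>has_prod\<close>.\<close>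

lemma q_infty_eq_inverse: "q_infty = inverse (weighted_gf (\<lambda>_. 1))"
proof -
  let ?f = "\<lambda>n. 1 - fps_X ^ Suc n :: ratfun fps"
  let ?P = "weighted_gf (\<lambda>_. 1 :: ratfun)"
  have "?P $ 0 = 1" by (simp add: weighted_gf_nth partitions_of_0)
  then have inv: "inverse ?P * ?P = 1" by (intro inverse_mult_eq_1) simp
  have Q: "(\<Prod>i\<le>M. ?f i) = qprod (Suc M) 1" for M
  proof -
    have "(\<Prod>i\<le>M. ?f i) = (\<Prod>k=Suc 0..Suc M. 1 - fps_X ^ k)"
      unfolding atMost_atLeast0 by (rule prod.shift_bounds_cl_Suc_ivl[symmetric])
    then show ?thesis by (simp only: fps_const_1_eq_1 mult_1 One_nat_def)
  qed
  from inv have inv': "?P * inverse ?P = 1" by (simp only: mult.commute)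
  have upto: "eq_upto N (qprod N 1) (inverse ?P)" for N
    using eq_upto_mult[OF eq_upto_prod_weighted_gf[of N "\<lambda>_. 1 :: ratfun"] eq_upto_refl[of N "inverse ?P"]]
    by (simp only: mult.assoc inv' mult_1_left mult_1_right)
  have lim: "(\<lambda>M. \<Prod>i\<le>M. ?f i) \<longlonglongrightarrow> inverse ?P"
  proof (rule tendsto_fpsI)
    fix n
    show "eventually (\<lambda>M. (\<Prod>i\<le>M. ?f i) $ n = inverse ?P $ n) sequentially"
      using eventually_ge_at_top[of n] unfolding Q
      by (rule eventually_mono) (use upto in \<open>unfold eq_upto_def, blast intro: le_SucI\<close>)
  qed
  have ne: "?f i \<noteq> 0" for i
  proof
    assume "?f i = 0"
    then have "?f i $ 0 = 0" by (simp only: fps_zero_nth)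
    moreover have "?f i $ 0 = 1" by (simp del: power_Suc)
    ultimately show False by simp
  qed
  have "inverse ?P \<noteq> 0" using inv by (metis mult_zero_left zero_neq_one)
  with lim have "raw_has_prod ?f 0 (inverse ?P)"
    unfolding raw_has_prod_def by (simp only: add_0_right simp_thms)
  then have has: "?f has_prod inverse ?P" unfolding has_prod_def by (rule disjI1)
  moreover have "p = inverse ?P" if "?f has_prod p" for p
  proof -
    have "raw_has_prod ?f 0 p" using that ne unfolding has_prod_def by blast
    then have "(\<lambda>M. \<Prod>i\<le>M. ?f i) \<longlonglongrightarrow> p"
      unfolding raw_has_prod_def by (simp only: add_0_right)
    then show ?thesis using lim by (rule LIMSEQ_unique)
  qed
  ultimately show ?thesis
    unfolding q_infty_def prodinf_def by (rule the_equality)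
qed

lemma eq_upto_q_infty: "eq_upto N q_infty (qprod N 1)"
proof -
  have "weighted_gf (\<lambda>_. 1 :: ratfun) $ 0 = 1" by (simp add: weighted_gf_nth partitions_of_0)
  then have "weighted_gf (\<lambda>_. 1) * q_infty = 1"
    unfolding q_infty_eq_inverse by (intro inverse_mult_eq_1') simp
  moreover have "eq_upto N (qprod N 1 * weighted_gf (\<lambda>_. 1) * q_infty) (1 * q_infty)"
    by (intro eq_upto_mult eq_upto_prod_weighted_gf eq_upto_refl)
  ultimately have "eq_upto N (qprod N 1) q_infty"
    by (simp only: mult.assoc mult_1_left mult_1_right)
  then show ?thesis by (rule eq_upto_sym)
qed

lemma pde_series_crank:
  "pde_series zvar rank_array = fps_const 2 * (fps_const zvar * q_infty ^ 2 * C_gf ^ 3)"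
proof (rule eq_upto_all)
  fix N
  define Q :: "ratfun fps" where "Q = qprod N 1"
  define P :: "ratfun fps" where "P = weighted_gf (\<lambda>_. 1)"
  define A where "A = qprod N zvar * qprod N (1 / zvar)"
  define W where "W = weighted_gf (\<lambda>_. zvar) * weighted_gf (\<lambda>_. 1 / zvar)"
  have AW: "eq_upto N (A * W) 1"
    using eq_upto_mult[OF eq_upto_prod_weighted_gf[of N "\<lambda>_. zvar"] eq_upto_prod_weighted_gf[of N "\<lambda>_. 1 / zvar"]]
    by (simp add: A_def W_def ac_simps)
  have QP: "eq_upto N (Q * P) 1"
    using eq_upto_prod_weighted_gf[of N "\<lambda>_. 1 :: ratfun"] by (simp add: Q_def P_def)
  have W: "W = C_gf * P" by (simp add: W_def P_def C_gf_product)
  have "eq_upto N (1 ^ 3 * pde_series zvar rank_array) ((A * W) ^ 3 * pde_series zvar rank_array)"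
    by (intro eq_upto_mult eq_upto_power eq_upto_sym[OF AW] eq_upto_refl)
  also have "(A * W) ^ 3 * pde_series zvar rank_array = W ^ 3 * (A ^ 3 * pde_series zvar rank_array)"
    by algebra
  also have "eq_upto N \<dots> (W ^ 3 * (fps_const zvar * (Q ^ 6 * pde_series 1 rank_array)))"
    unfolding A_def Q_def using zvar_neq_0 by (intro eq_upto_mult eq_upto_refl theta_pde_series)
  \<comment> \<open>Three factors P from \<open>W = C_gf * P\<close> and one from z = 1 pair off
    with four of the six factors Q; the remaining \<open>Q ^ 2\<close> is the square of
    \<open>q_infty\<close> in the theorem.\<close>
  also have "W ^ 3 * (fps_const zvar * (Q ^ 6 * pde_series 1 rank_array)) =
      fps_const 2 * (fps_const zvar * Q ^ 2 * C_gf ^ 3) * (Q * P) ^ 4"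
    unfolding W pde_series_1 P_def[symmetric] by algebra
  also have "eq_upto N \<dots> (fps_const 2 * (fps_const zvar * q_infty ^ 2 * C_gf ^ 3) * 1 ^ 4)"
    unfolding Q_def by (intro eq_upto_mult eq_upto_power eq_upto_refl eq_upto_sym[OF eq_upto_q_infty] QP[unfolded Q_def])
  finally show "eq_upto N (pde_series zvar rank_array) (fps_const 2 * (fps_const zvar * q_infty ^ 2 * C_gf ^ 3))"
    by simp
qed

section \<open>From arrays back to \<open>delta_q\<close> and \<open>delta_z\<close>\<close>

lemma R_gf_array_series: "R_gf = array_series zvar rank_array"
proof (rule fps_ext)
  fix n show "R_gf $ n = array_series zvar rank_array $ n"
    using rank_eq_support by (subst array_series_nth[of "{- int n..int n}"]) (auto simp: R_gf_def rank_array_def rank_eq_N_rank)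
qed

lemma delta_q_array_series:
  assumes "laurent_array r"
  shows "delta_q (array_series z r) = array_series z (\<lambda>m n. of_int n * r m n)"
proof (rule fps_ext)
  fix n
  have "array_series z (\<lambda>m n. of_int n * r m n) $ n = (\<Sum>m | r m (int n) \<noteq> 0. of_int (int n) * r m (int n) * z powi m)"
    using assms by (intro array_series_nth) (auto simp: laurent_array_def)
  also have "\<dots> = of_nat n * array_series z r $ n" by (simp add: array_series_def sum_distrib_left mult.assoc)
  finally show "delta_q (array_series z r) $ n = array_series z (\<lambda>m n. of_int n * r m n) $ n"
    by (cases n) (simp_all add: delta_q_def)
qed

lemma delta_z_array_series:
  assumes "laurent_array (\<lambda>m n. of_int (c m n) :: ratfun)"
  shows "delta_z (array_series zvar (\<lambda>m n. of_int (c m n))) = array_series zvar (\<lambda>m n. of_int m * of_int (c m n))"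
proof (rule fps_ext)
  fix n
  let ?A = "{m. (of_int (c m (int n)) :: ratfun) \<noteq> 0}"
  have "array_series zvar (\<lambda>m n. of_int m * of_int (c m n)) $ n =
      (\<Sum>m\<in>?A. of_int m * of_int (c m (int n)) * zvar powi m)"
    using assms by (intro array_series_nth) (auto simp: laurent_array_def)
  also have "\<dots> = (\<Sum>m\<in>?A. of_int (c m (int n)) * (zvar * ratfun_deriv (zvar powi m)))"
    by (intro sum.cong refl) (simp add: zvar_times_deriv_powi ac_simps)
  also have "\<dots> = zvar * ratfun_deriv (array_series zvar (\<lambda>m n. of_int (c m n)) $ n)"
    by (simp add: array_series_def ratfun_deriv_sum ratfun_deriv_mult ratfun_deriv_of_int sum_distrib_left ac_simps)
  finally show "delta_z (array_series zvar (\<lambda>m n. of_int (c m n))) $ n =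
      array_series zvar (\<lambda>m n. of_int m * of_int (c m n)) $ n"
    by (simp add: delta_z_def)
qed

lemma delta_z_R_gf:
  "delta_z R_gf = array_series zvar (\<lambda>m n. of_int m * rank_array m n)"
  "delta_z (delta_z R_gf) = array_series zvar (\<lambda>m n. of_int (m * m) * rank_array m n)"
proof -
  have r: "of_int (int (rank_eq m n)) = (rank_array m n :: ratfun)" for m n
    by (simp add: rank_array_def)
  have n: "laurent_array (\<lambda>m n. of_int (int (rank_eq m n)) :: ratfun)"
    unfolding r by (rule laurent_array_rank_array)
  show 1: "delta_z R_gf = array_series zvar (\<lambda>m n. of_int m * rank_array m n)"
    using delta_z_array_series[OF n] unfolding r R_gf_array_series .
  have "laurent_array (\<lambda>m n. of_int (m * int (rank_eq m n)) :: ratfun)"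
    unfolding of_int_mult using n by (rule laurent_array_scale)
  note delta_z_array_series[OF this]
  then show "delta_z (delta_z R_gf) = array_series zvar (\<lambda>m n. of_int (m * m) * rank_array m n)"
    unfolding 1 of_int_mult r by (simp only: mult.assoc)
qed

lemma fps_const_half: "fps_const 2 * fps_const (1 / 2) = (1 :: ratfun fps)"
  using two_ratfun_neq_0 by (simp flip: fps_const_1_eq_1)

lemma fps_const_pde_coeffs:
  fixes z :: "'a::field"
  shows "fps_const ((1 - z) ^ 2) = (1 - fps_const z) ^ 2"
    "fps_const (1 / 2 * (1 - z) ^ 2) = fps_const (1 / 2) * (1 - fps_const z) ^ 2"
    "fps_const (1 / 2 * (z ^ 2 - 1)) = fps_const (1 / 2) * (fps_const z ^ 2 - 1)"
  by (simp_all only: fps_const_mult[symmetric] fps_const_power[symmetric] fps_const_sub[symmetric] fps_const_1_eq_1)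

lemma rank_crank_pde_R_gf:
  "fps_const zvar * q_infty ^ 2 * C_gf ^ 3 =
     3 * fps_const ((1 - zvar) ^ 2) * delta_q R_gf
       + fps_const (1 / 2 * (1 - zvar) ^ 2) * delta_z (delta_z R_gf)
       - fps_const (1 / 2 * (zvar ^ 2 - 1)) * delta_z R_gf
       + fps_const zvar * R_gf" (is "?L = ?R")
proof -
  define h where "h = fps_const (1 / 2 :: ratfun)"
  define c where "c = fps_const zvar"
  have h: "2 * h = 1" using fps_const_half by (simp add: h_def numeral_fps_const)
  have e: "array_series zvar (\<lambda>m n. of_int (6 * n) * rank_array m n) = fps_const 6 * delta_q R_gf"
    unfolding R_gf_array_series delta_q_array_series[OF laurent_array_rank_array] 
    by (subst array_series_scale[symmetric]) (simp_all add: laurent_array_scale laurent_array_rank_array mult.assoc)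
  have "pde_series zvar rank_array =
      (1 - c) ^ 2 * (6 * delta_q R_gf) + ((1 - c) ^ 2 * delta_z (delta_z R_gf)
       + ((1 - c ^ 2) * delta_z R_gf + 2 * (c * R_gf)))"
    unfolding pde_series_def e delta_z_R_gf[symmetric] R_gf_array_series[symmetric] c_def
    by (simp add: numeral_fps_const fps_const_power)
  also have "\<dots> = 2 * (3 * (1 - c) ^ 2 * delta_q R_gf + h * (1 - c) ^ 2 * delta_z (delta_z R_gf)
       - h * (c ^ 2 - 1) * delta_z R_gf + c * R_gf)"
    using h by algebra
  also have "\<dots> = 2 * ?R"
    by (simp only: h_def c_def fps_const_pde_coeffs)
  finally have "2 * ?L = 2 * ?R"
    unfolding pde_series_crank by (simp add: numeral_fps_const)
  moreover have "(2 :: ratfun fps) \<noteq> 0" using h by (metis mult_zero_left zero_neq_one)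
  ultimately show ?thesis by (metis mult_left_cancel)
qed

lemma delta_z_const_mult:
  "delta_z (fps_const a * F) = fps_const (zvar * ratfun_deriv a) * F + fps_const a * delta_z F"
  by (rule fps_ext) (simp add: delta_z_def ratfun_deriv_mult algebra_simps)

lemma delta_z_add: "delta_z (F + G) = delta_z F + delta_z G"
  by (rule fps_ext) (simp add: delta_z_def ratfun_deriv_add algebra_simps)

lemma delta_q_const_mult: "delta_q (fps_const a * F) = fps_const a * delta_q F"
  by (simp add: delta_q_def)

theorem theorem1p1:
  shows "fps_const zvar * q_infty ^ 2 * C_star ^ 3 =
           3 * delta_q R_star + fps_const (1 / 2) * delta_z R_star
             + fps_const (1 / 2) * delta_z (delta_z R_star)
       \<and> fps_const zvar * q_infty ^ 2 * C_gf ^ 3 =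
           3 * fps_const ((1 - zvar) ^ 2) * delta_q R_gf
             + fps_const (1 / 2 * (1 - zvar) ^ 2) * delta_z (delta_z R_gf)
             - fps_const (1 / 2 * (zvar ^ 2 - 1)) * delta_z R_gf
             + fps_const zvar * R_gf"
proof
  define h where "h = fps_const (1 / 2 :: ratfun)"
  define c where "c = fps_const zvar"
  define d where "d = fps_const (1 - zvar)"
  have h: "2 * h = 1" using fps_const_half by (simp add: h_def numeral_fps_const)
  have d: "d = 1 - c" by (simp add: d_def c_def flip: fps_const_sub)
  have d0: "d \<noteq> 0" using zvar_neq_1 by (simp add: d_def)
  have div: "F = d * (F / fps_const (1 - zvar))" for F
    using d0 by (simp add: d_def fps_divide_unit)
  have R: "R_gf = d * R_star" unfolding R_star_def by (rule div)
  have C: "C_gf = d * C_star" unfolding C_star_def by (rule div)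
  have dz: "delta_z (d * F) = d * delta_z F - c * F" for F
    unfolding d_def delta_z_const_mult
    by (simp add: ratfun_deriv_diff ratfun_deriv_1 ratfun_deriv_zvar c_def flip: fps_const_neg)
  have dzc: "delta_z (c * F) = c * F + c * delta_z F" for F
    unfolding c_def delta_z_const_mult by (simp add: ratfun_deriv_zvar)
  have dzd: "delta_z (F - G) = delta_z F - delta_z G" for F G
    using delta_z_add[of "F - G" G] by simp
  have dq: "delta_q (d * F) = d * delta_q F" for F unfolding d_def by (rule delta_q_const_mult)
  have "c * q_infty ^ 2 * C_gf ^ 3 = 3 * d ^ 2 * delta_q R_gf + h * d ^ 2 * delta_z (delta_z R_gf)
       - h * (c ^ 2 - 1) * delta_z R_gf + c * R_gf"
    using rank_crank_pde_R_gf unfolding fps_const_pde_coeffs d by (simp only: h_def c_def)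
  \<comment> \<open>The first identity is the second one with R and C written as 1 - z times the
    starred series; by the product rule \<open>dz\<close> all terms combine into a multiple of
    \<open>d ^ 3\<close>.\<close>
  note this[unfolded R C dz dzd dzc dq]
  then have "d ^ 3 * (c * q_infty ^ 2 * C_star ^ 3) =
      d ^ 3 * (3 * delta_q R_star + h * delta_z R_star + h * delta_z (delta_z R_star))"
    using h unfolding d by algebra
  then show "fps_const zvar * q_infty ^ 2 * C_star ^ 3 =
      3 * delta_q R_star + fps_const (1 / 2) * delta_z R_star + fps_const (1 / 2) * delta_z (delta_z R_star)"
    using d0 by (simp add: h_def c_def)
qed (rule rank_crank_pde_R_gf)

end
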